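(* Let $p\in(1,\infty)$, $\alpha>0$, and $0<s<t<\alpha$. Then there exists a positive constant $C$, independent of $s$ and $t$, such that for all $f\in L^p(\mathbb{R}^n)$ $$\|f\|_{L^p(\mathbb{R}^n)}+\min\{s,\alpha-s\}^{\frac1p}\|f\|_{\dot W^{s,p}(\mathbb{R}^n),\alpha}\le C\Big(\|f\|_{L^p(\mathbb{R}^n)}+\min\{t,\alpha-t\}^{\frac1p}\|f\|_{\dot W^{t,p}(\mathbb{R}^n),\alpha}\Big).$$ In particular, if $\alpha=1$ then $$\|f\|_{L^p(\mathbb{R}^n)}+\min\{s,1-s\}^{\frac1p}\|f\|_{\dot W^{s,p}(\mathbb{R}^n)}\le C\Big(\|f\|_{L^p(\mathbb{R}^n)}+\min\{t,1-t\}^{\frac1p}\|f\|_{\dot W^{t,p}(\mathbb{R}^n)}\Big)$$ for all $0<s<t<1$.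
   Context: For $\alpha>0$ and $h\in\mathbb{R}^n$ the fractional difference of order $\alpha$ is $$\Delta_h^\alpha f(x)=\sum_{j=0}^\infty(-1)^j\binom{\alpha}{j}f(x+(\alpha-j)h),\qquad \binom{\alpha}{j}=\frac{\alpha(\alpha-1)\cdots(\alpha-j+1)}{j!},\quad \binom \alpha0=1$$ (the series converges in $L^p(\mathbb{R}^n)$ for $f\in L^p(\mathbb{R}^n)$). For $0<s<\alpha$ and $p<\infty$ the Butzer seminorm is $$\|f\|_{\dot W^{s,p}(\mathbb{R}^n),\alpha}=\Big(\int_{\mathbb{R}^n}\int_{\mathbb{R}^n}\frac{|\Delta_h^\alpha f(x)|^p}{|h|^{sp+n}}\,dx\,dh\Big)^{1/p}\in[0,\infty].$$ For $s\in(0,1)$ the Gagliardo seminorm is $\|f\|_{\dot W^{s,p}(\mathbb{R}^n)}=\big(\int_{\mathbb{R}^n}\int_{\mathbb{R}^n}\frac{|f(x)-f(y)|^p}{|x-y|^{sp+n}}dx\,dy\big)^{1/p}$, which equals $\|f\|_{\dot W^{s,p}(\mathbb{R}^n),1}$. The constant $C$ is also independent of $f$. *)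

theory Defs
  imports "HOL-Analysis.Analysis"
begin

text \<open>
  Functions on \<open>\<real>\<^sup>n\<close> are complex valued, which includes the real-valued ones. Elements of
  \<open>L\<^sup>p\<close> are represented by Lebesgue measurable functions; all quantities below are unchanged
  when a function is modified on a Lebesgue null set.
\<close>

definition Lp :: "real \<Rightarrow> (real ^ 'n \<Rightarrow> complex) set" where
  "Lp p = {f \<in> borel_measurable lebesgue. integrable lebesgue (\<lambda>x. norm (f x) powr p)}"

text \<open>Real powers on \<open>[0,\<infinity>]\<close>, meant for positive exponents: \<open>\<infinity>\<close> to the power \<open>a\<close> is \<open>\<infinity>\<close>.\<close>

definition ennreal_pow :: "ennreal \<Rightarrow> real \<Rightarrow> ennreal" where
  "ennreal_pow x a = (if x = \<infinity> then \<infinity> else ennreal (enn2real x powr a))"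

definition Lp_norm :: "real \<Rightarrow> (real ^ 'n \<Rightarrow> complex) \<Rightarrow> ennreal" where
  "Lp_norm p f = ennreal_pow (\<integral>\<^sup>+ x. ennreal (norm (f x) powr p) \<partial>lebesgue) (1 / p)"

text \<open>
  The binomial coefficients of order \<open>\<alpha> > 0\<close> are absolutely summable, so by Minkowski's inequality
  the series below converges absolutely for almost every \<open>x\<close> when \<open>f \<in> L\<^sup>p\<close>, \<open>p \<ge> 1\<close>, and its
  pointwise sum agrees almost everywhere with the sum of the series in \<open>L\<^sup>p\<close>.
\<close>

definition frac_diff :: "real \<Rightarrow> real ^ 'n \<Rightarrow> (real ^ 'n \<Rightarrow> complex) \<Rightarrow> real ^ 'n \<Rightarrow> complex" where
  "frac_diff \<alpha> h f x =
     (\<Sum>j. ((-1) ^ j * (\<alpha> gchoose j)) *\<^sub>R f (x + (\<alpha> - real j) *\<^sub>R h))"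

text \<open>
  In both seminorms the integrand takes the value \<open>0\<close> where the denominator vanishes
  (\<open>h = 0\<close>, respectively \<open>x = y\<close>); for the outer, respectively the inner integral this is a
  single point and hence irrelevant.
\<close>

definition Butzer_seminorm :: "real \<Rightarrow> real \<Rightarrow> real \<Rightarrow> (real ^ 'n \<Rightarrow> complex) \<Rightarrow> ennreal" where
  "Butzer_seminorm s p \<alpha> f =
     ennreal_pow
       (\<integral>\<^sup>+ h. (\<integral>\<^sup>+ x. ennreal (norm (frac_diff \<alpha> h f x) powr p
                                / norm h powr (s * p + real CARD('n))) \<partial>lebesgue) \<partial>lebesgue)
       (1 / p)"

definition Gagliardo_seminorm :: "real \<Rightarrow> real \<Rightarrow> (real ^ 'n \<Rightarrow> complex) \<Rightarrow> ennreal" where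
  "Gagliardo_seminorm s p f =
     ennreal_pow
       (\<integral>\<^sup>+ y. (\<integral>\<^sup>+ x. ennreal (norm (f x - f y) powr p
                                / norm (x - y) powr (s * p + real CARD('n))) \<partial>lebesgue) \<partial>lebesgue)
       (1 / p)"

end

theory Submission
  imports Defs
begin

text \<open>
  Write \<open>\<Phi>(h)\<close> for the \<open>p\<close>-th power of the \<open>L\<^sup>p\<close> norm of \<open>\<Delta>\<^sub>h\<^sup>\<alpha> f\<close>. The \<open>p\<close>-th power of the seminorm of
  order \<open>s\<close> is the integral of \<open>\<Phi>(h)\<close> against the weight \<open>|h|\<close> to the power \<open>-sp-n\<close>. The theorem
  compares these weighted integrals for two exponents \<open>s < t\<close>, with the factors \<open>min {s, \<alpha> - s}\<close>.

  The part \<open>|h| \<ge> 1\<close> is harmless: \<open>\<Phi>\<close> is bounded by a multiple of the \<open>p\<close>-th power of the norm of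
  \<open>f\<close>, and \<open>s\<close> times the integral of the weight stays bounded as \<open>s\<close> tends to \<open>0\<close>
  (\<open>outer_integral_le\<close>). On \<open>|h| < 1\<close> the weights increase with the exponent, which settles the case
  \<open>min {s, \<alpha> - s} \<le> 2 min {t, \<alpha> - t}\<close>. In the remaining case \<open>t\<close> is much closer to \<open>\<alpha>\<close> than \<open>s\<close> is,
  and the loss of the small factor \<open>\<alpha> - t\<close> has to be recovered from the regularity of \<open>\<Phi>\<close>. What is
  used is that \<open>\<Phi>\<close> grows at most like \<open>|h|\<close> to the power \<open>\<alpha>p\<close> under dilations,
  \<open>\<Phi>(Mh) \<le> C M\<^sup>\<alpha>\<^sup>p \<Phi>(h)\<close>, with one constant for all integers \<open>M \<ge> 1\<close>
  (\<open>frac_modulus_dilate\<close>). Applying this with \<open>M = 2\<^sup>N\<close> and averaging over \<open>N\<close> with geometric weights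
  turns the weight of exponent \<open>s\<close> into that of exponent \<open>t\<close> and produces exactly the quotient
  \<open>(\<alpha> - t) / (\<alpha> - s)\<close> (\<open>inner_integral_average\<close>, \<open>inner_integral_gain\<close>).

  The dilation estimate is a statement about power series. Let \<open>z\<close> stand for the translation by
  \<open>-h\<close>; up to a translation, \<open>\<Delta>\<^sub>h\<^sup>\<alpha>\<close> is the series \<open>(1 - z)\<^sup>\<alpha>\<close> and \<open>\<Delta>\<^sub>M\<^sub>h\<^sup>\<alpha>\<close> is \<open>(1 - z\<^sup>M)\<^sup>\<alpha>\<close>. A power series
  with absolutely summable coefficients acts on \<open>L\<^sup>p\<close> with norm at most the sum of the moduli of its
  coefficients. It therefore suffices that the coefficients of
  \<open>((1 - z\<^sup>M) / (1 - z))\<^sup>\<alpha>\<close> have absolute sum at most \<open>C M\<^sup>\<alpha>\<close>. For integer \<open>\<alpha>\<close> this is clear, since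
  the quotient is a geometric sum; for fractional \<open>\<alpha>\<close> the coefficients change sign, and iterating a
  bound for \<open>M = 2\<close> would lose a power of \<open>M\<close>, which would destroy uniformity as \<open>t\<close> tends to \<open>\<alpha>\<close>.
  The uniform bound (\<open>fps_l1_binom_quotient\<close>) comes from the differential equation that the quotient
  satisfies.

  The Gagliardo seminorm is the case \<open>\<alpha> = 1\<close> after the substitution \<open>x = y + h\<close>.
\<close>

unbundle no vec_syntax
unbundle fps_syntax

section \<open>The Wiener algebra of power series\<close>

lemma suminf_ennreal_swap: "(\<Sum>i. \<Sum>j. f i j) = (\<Sum>j. \<Sum>i. f i j :: ennreal)"
  using nn_integral_suminf[of f "count_space UNIV"]
  by (simp add: nn_integral_count_space_nat)

text \<open>
  Summation along the antidiagonals of a quadrant. No convergence question arises for values in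
  \<open>[0,\<infinity>]\<close>, so this is the one rearrangement behind all product estimates below.
\<close>

lemma suminf_ennreal_Cauchy:
  fixes f :: "nat \<Rightarrow> nat \<Rightarrow> ennreal"
  shows "(\<Sum>n. \<Sum>i\<le>n. f i (n - i)) = (\<Sum>i. \<Sum>j. f i j)"
proof -
  have "(\<Sum>n. \<Sum>i\<le>n. f i (n - i)) = (\<Sum>n. \<Sum>i. if i \<le> n then f i (n - i) else 0)"
  proof (rule suminf_cong)
    fix n
    have "(\<Sum>i. if i \<le> n then f i (n - i) else 0) = (\<Sum>i\<le>n. if i \<le> n then f i (n - i) else 0)"
      by (rule suminf_finite) auto
    then show "(\<Sum>i\<le>n. f i (n - i)) = (\<Sum>i. if i \<le> n then f i (n - i) else 0)" by simp
  qed
  also have "\<dots> = (\<Sum>i. \<Sum>n. if i \<le> n then f i (n - i) else 0)"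
    by (rule suminf_ennreal_swap)
  also have "\<dots> = (\<Sum>i. \<Sum>j. f i j)"
  proof (rule suminf_cong)
    fix i
    show "(\<Sum>n. if i \<le> n then f i (n - i) else 0) = (\<Sum>j. f i j)"
      by (subst suminf_offset[of _ i]) simp_all
  qed
  finally show ?thesis .
qed

lemma suminf_ennreal_multiples:
  fixes g :: "nat \<Rightarrow> ennreal"
  assumes "M > 0"
  shows "(\<Sum>n. if M dvd n then g (n div M) else 0) = (\<Sum>k. g k)"
proof -
  have "(\<lambda>k. (\<lambda>n. if M dvd n then g (n div M) else 0) (k * M)) sums suminf g"
    using assms by (simp add: summable_sums)
  then have "(\<lambda>n. if M dvd n then g (n div M) else 0) sums suminf g"
    apply (subst (asm) sums_mono_reindex)
    using assms by (auto simp: strict_mono_def dvd_def image_iff mult.commute)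
  then show ?thesis by (rule sums_unique[symmetric])
qed

definition fps_l1 :: "real fps \<Rightarrow> ennreal" where
  "fps_l1 F = (\<Sum>n. ennreal \<bar>F $ n\<bar>)"

lemma fps_l1_add: "fps_l1 (F + G) \<le> fps_l1 F + fps_l1 G"
  unfolding fps_l1_def
  by (subst suminf_add) (auto intro!: suminf_le simp flip: ennreal_plus intro: ennreal_leI)

lemma fps_l1_const [simp]: "fps_l1 (fps_const c) = ennreal \<bar>c\<bar>"
proof -
  have "fps_l1 (fps_const c) = (\<Sum>n\<in>{0}. ennreal \<bar>fps_const c $ n\<bar>)"
    unfolding fps_l1_def by (rule suminf_finite) auto
  then show ?thesis by simp
qed

lemma fps_l1_mult: "fps_l1 (F * G) \<le> fps_l1 F * fps_l1 G"
proof -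
  have "fps_l1 (F * G) \<le> (\<Sum>n. \<Sum>i\<le>n. ennreal \<bar>F $ i\<bar> * ennreal \<bar>G $ (n - i)\<bar>)"
    unfolding fps_l1_def
  proof (intro suminf_le)
    fix n
    have "\<bar>(F * G) $ n\<bar> \<le> (\<Sum>i\<le>n. \<bar>F $ i\<bar> * \<bar>G $ (n - i)\<bar>)"
      unfolding fps_mult_nth atMost_atLeast0 by (rule order_trans[OF sum_abs]) (simp add: abs_mult)
    then show "ennreal \<bar>(F * G) $ n\<bar> \<le> (\<Sum>i\<le>n. ennreal \<bar>F $ i\<bar> * ennreal \<bar>G $ (n - i)\<bar>)"
      by (simp add: ennreal_leI flip: ennreal_mult)
  qed auto
  also have "\<dots> = (\<Sum>i. \<Sum>j. ennreal \<bar>F $ i\<bar> * ennreal \<bar>G $ j\<bar>)"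
    by (rule suminf_ennreal_Cauchy)
  also have "\<dots> = fps_l1 F * fps_l1 G" by (simp add: fps_l1_def)
  finally show ?thesis .
qed

section \<open>Binomial series\<close>

text \<open>
  The series \<open>(1 - z)\<^sup>a\<close>; its coefficients are those of the fractional difference of order \<open>a\<close>.
\<close>

definition binom_fps :: "real \<Rightarrow> real fps" where
  "binom_fps a = Abs_fps (\<lambda>n. (-1) ^ n * (a gchoose n))"

lemma binom_fps_nth: "binom_fps a $ n = (-1) ^ n * (a gchoose n)"
  by (simp add: binom_fps_def)

lemma binom_fps_altdef: "binom_fps a = fps_binomial a oo (- fps_X)"
proof -
  have "- fps_X = fps_const (-1) * (fps_X :: real fps)"
    by (simp add: numeral_fps_const flip: fps_const_neg)
  moreover have "binom_fps a = fps_binomial a oo (fps_const (-1) * fps_X)"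
    by (simp only: fps_eq_iff binom_fps_nth fps_nth_compose_linear fps_binomial_nth) simp
  ultimately show ?thesis by (simp only:)
qed

lemma binom_fps_add: "binom_fps (a + b) = binom_fps a * binom_fps b"
  by (simp add: binom_fps_altdef fps_binomial_add_mult fps_compose_mult_distrib)

lemma binom_fps_0 [simp]: "binom_fps 0 = 1"
  by (simp add: binom_fps_altdef)

lemma binom_fps_1: "binom_fps 1 = 1 - fps_X"
  by (simp add: binom_fps_altdef fps_binomial_1 fps_compose_add_distrib)

lemma fps_deriv_binom_fps: "fps_deriv (binom_fps a) = - fps_const a * binom_fps (a - 1)"
proof (rule fps_ext)
  fix n
  have "real (Suc n) * (a gchoose Suc n) = a * (a - 1 gchoose n)"
    by (rule gbinomial_absorption)
  then have "(-1) ^ n * (real (Suc n) * (a gchoose Suc n)) = (-1) ^ n * (a * (a - 1 gchoose n))"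
    by (rule arg_cong)
  then show "fps_deriv (binom_fps a) $ n = (- fps_const a * binom_fps (a - 1)) $ n"
    by (simp add: binom_fps_nth algebra_simps)
qed

lemma binom_fps_nth_Suc: "binom_fps a $ Suc n = binom_fps a $ n * (1 - (a + 1) / real (Suc n))"
proof -
  have "real (Suc n) * (a gchoose Suc n) = a * (a - 1 gchoose n)"
    by (rule gbinomial_absorption)
  also have "\<dots> = (a - real n) * (a gchoose n)"
    by (rule gbinomial_absorb_comp[symmetric])
  finally have "a gchoose Suc n = (a - real n) * (a gchoose n) / real (Suc n)"
    by (simp add: nonzero_eq_divide_eq mult.commute del: of_nat_Suc)
  moreover have "1 - (a + 1) / real (Suc n) = - ((a - real n) / real (Suc n))"
    by (simp add: field_simps)
  ultimately show ?thesis by (simp only: binom_fps_nth) (simp del: of_nat_Suc)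
qed

lemma Bernoulli_powr_concave:
  fixes \<gamma> x :: real
  assumes "0 \<le> \<gamma>" "\<gamma> \<le> 1" "-1 < x"
  shows "(1 + x) powr \<gamma> \<le> 1 + \<gamma> * x"
  using Youngs_inequality_0[of \<gamma> "1 - \<gamma>" "1 + x" 1] assms by (simp add: algebra_simps)

text \<open>
  Comparison with the integral of \<open>x\<close> to the power \<open>-\<gamma>\<close>; the induction step is Bernoulli's
  inequality for the exponent \<open>1 - \<gamma>\<close> at \<open>-1/n\<close>.
\<close>

lemma sum_powr_le:
  fixes \<gamma> :: real
  assumes "0 \<le> \<gamma>" "\<gamma> < 1"
  shows "(\<Sum>k<M. real (Suc k) powr (- \<gamma>)) \<le> real M powr (1 - \<gamma>) / (1 - \<gamma>)"
proof (induction M)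
  case (Suc M)
  define n where "n = real (Suc M)"
  have n: "n \<ge> 1" "real M = n * (1 - 1 / n)" by (auto simp: n_def field_simps)
  have M: "real M powr (1 - \<gamma>) \<le> n powr (1 - \<gamma>) * (1 - (1 - \<gamma>) * (1 / n))"
  proof (cases "M = 0")
    case False
    then have "n > 1" by (simp add: n_def)
    then have "(1 + (- (1 / n))) powr (1 - \<gamma>) \<le> 1 + (1 - \<gamma>) * (- (1 / n))"
      using assms by (intro Bernoulli_powr_concave) auto
    then show ?thesis using \<open>n > 1\<close> by (simp add: n(2) powr_mult)
  qed (use assms in \<open>auto simp: n_def\<close>)
  have "n powr (- \<gamma>) = n powr (1 - \<gamma>) * (1 / n)"
    using n by (simp add: powr_diff powr_minus field_simps)
  with M have "real M powr (1 - \<gamma>) + (1 - \<gamma>) * n powr (- \<gamma>) \<le> n powr (1 - \<gamma>)"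
    by (simp add: algebra_simps)
  then have "(real M powr (1 - \<gamma>) + (1 - \<gamma>) * n powr (- \<gamma>)) / (1 - \<gamma>)
      \<le> n powr (1 - \<gamma>) / (1 - \<gamma>)"
    using assms by (intro divide_right_mono) auto
  then have "real M powr (1 - \<gamma>) / (1 - \<gamma>) + n powr (- \<gamma>) \<le> n powr (1 - \<gamma>) / (1 - \<gamma>)"
    using assms by (simp add: add_divide_distrib)
  with Suc show ?case by (simp add: n_def)
qed auto

text \<open>
  For \<open>0 \<le> \<gamma> \<le> 1\<close> the coefficients of \<open>(1 - z)\<close> to the power \<open>\<gamma> - 1\<close> are the products of the factors
  \<open>1 - \<gamma>/i\<close>. All estimates of binomial coefficients in this development reduce to three facts
  about these products: they are nonnegative, decrease in \<open>n\<close>, and are at most \<open>n + 1\<close> to the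
  power \<open>-\<gamma>\<close>.
\<close>

lemma binom_fps_nth_nonneg:
  assumes "\<gamma> \<le> 1"
  shows "0 \<le> binom_fps (\<gamma> - 1) $ n"
proof (induction n)
  case (Suc n)
  have "\<gamma> / real (Suc n) \<le> 1" using assms by simp
  then show ?case using Suc by (simp add: binom_fps_nth_Suc del: of_nat_Suc)
qed (simp add: binom_fps_nth)

lemma binom_fps_nth_decreasing:
  assumes "0 \<le> \<gamma>" "\<gamma> \<le> 1"
  shows "binom_fps (\<gamma> - 1) $ Suc n \<le> binom_fps (\<gamma> - 1) $ n"
proof -
  have "0 \<le> \<gamma> / real (Suc n)" using assms by simp
  then show ?thesis using binom_fps_nth_nonneg[OF assms(2), of n]
    by (simp add: binom_fps_nth_Suc mult_left_le del: of_nat_Suc)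
qed

text \<open>
  Each new factor satisfies \<open>(1 - \<gamma>/m)(1 + 1/m)\<^sup>\<gamma> \<le> (1 - \<gamma>/m)(1 + \<gamma>/m) \<le> 1\<close>, again by Bernoulli's
  inequality.
\<close>

lemma binom_fps_nth_le:
  assumes "0 \<le> \<gamma>" "\<gamma> \<le> 1"
  shows "binom_fps (\<gamma> - 1) $ n \<le> real (Suc n) powr (- \<gamma>)"
proof (induction n)
  case (Suc n)
  define m where "m = real (Suc n)"
  have m: "m \<ge> 1" "real (Suc (Suc n)) = m * (1 + 1 / m)" by (auto simp: m_def field_simps)
  have *: "(1 - \<gamma> / m) * (1 + 1 / m) powr \<gamma> \<le> 1"
  proof -
    have "(1 - \<gamma> / m) * (1 + 1 / m) powr \<gamma> \<le> (1 - \<gamma> / m) * (1 + \<gamma> * (1 / m))"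
      using assms m by (intro mult_left_mono Bernoulli_powr_concave) (auto simp: field_simps intro: order_trans[of _ 0])
    also have "\<dots> = 1 - (\<gamma> / m)\<^sup>2" by (simp add: power2_eq_square algebra_simps)
    finally show ?thesis by (smt (verit) zero_le_power2)
  qed
  have "0 \<le> 1 - \<gamma> / m" using assms m by (simp add: field_simps)
  then have "binom_fps (\<gamma> - 1) $ Suc n \<le> m powr (- \<gamma>) * (1 - \<gamma> / m)"
    using Suc unfolding binom_fps_nth_Suc m_def by (intro mult_mono) auto
  also have "\<dots> \<le> m powr (- \<gamma>) * (1 + 1 / m) powr (- \<gamma>)"
  proof (intro mult_left_mono)
    have "1 + 1 / m > 0" using m by (intro add_pos_nonneg) auto
    then have "(1 + 1 / m) powr \<gamma> > 0" by simp
    with * show "1 - \<gamma> / m \<le> (1 + 1 / m) powr (- \<gamma>)"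
      by (simp add: powr_minus field_simps)
  qed auto
  also have "\<dots> = real (Suc (Suc n)) powr (- \<gamma>)" using m by (simp add: powr_mult)
  finally show ?case .
qed (simp add: binom_fps_nth)

lemma fps_one_minus_X_mult_nth:
  "((1 - fps_X) * W) $ n = W $ n - (if n = 0 then 0 else W $ (n - 1) :: real)"
  by (simp add: algebra_simps)

text \<open>
  Multiplication by \<open>1 - z\<close> takes differences of coefficients. For a sequence that starts at index
  \<open>M\<close> and decreases from there, these are one upward jump followed by downward steps, so the
  absolute sum telescopes to at most twice the jump.
\<close>

lemma fps_l1_one_minus_X_mult_le:
  assumes "\<And>n. n < M \<Longrightarrow> W $ n = 0" "\<And>n. 0 \<le> W $ n"
    and "\<And>n. M \<le> n \<Longrightarrow> W $ Suc n \<le> W $ n"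
  shows "fps_l1 ((1 - fps_X) * W) \<le> ennreal (2 * W $ M)"
  unfolding fps_l1_def
proof (rule suminf_le_const)
  fix n
  let ?c = "\<lambda>i. \<bar>((1 - fps_X) * W) $ i\<bar>"
  have *: "(\<Sum>i\<le>K. ?c i) = (if K < M then 0 else 2 * W $ M - W $ K)" for K
  proof (induction K)
    case 0
    show ?case using assms(1)[of 0] assms(2)[of 0] by (simp add: fps_one_minus_X_mult_nth)
  next
    case (Suc K)
    consider "Suc K < M" | "Suc K = M" | "M \<le> K" by linarith
    then show ?case
      using Suc assms(1)[of "Suc K"] assms(1)[of K] assms(2)[of "Suc K"] assms(3)[of K]
      by cases (auto simp: fps_one_minus_X_mult_nth)
  qed
  have "(\<Sum>i<n. ?c i) \<le> (\<Sum>i\<le>n. ?c i)" by (intro sum_mono2) auto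
  also have "\<dots> \<le> 2 * W $ M" using *[of n] assms(2)[of n] assms(2)[of M] by auto
  finally show "(\<Sum>i<n. ennreal (?c i)) \<le> ennreal (2 * W $ M)"
    by (simp add: ennreal_leI)
qed simp

lemma fps_l1_one_minus_X: "fps_l1 (1 - fps_X) \<le> 2"
  using fps_l1_one_minus_X_mult_le[of 0 1] by simp

lemma binom_fps_minus_1: "(1 - fps_X) * binom_fps (a - 1) = binom_fps a"
  using binom_fps_add[of 1 "a - 1"] by (simp add: binom_fps_1)

text \<open>
  For \<open>0 \<le> b \<le> 1\<close> write \<open>(1 - z)\<^sup>b\<close> as \<open>1 - z\<close> times a series with decreasing coefficients; every
  further factor \<open>1 - z\<close> at most doubles the norm.
\<close>

lemma fps_l1_binom_fps_finite:
  assumes "0 \<le> a"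
  shows "fps_l1 (binom_fps a) < \<infinity>"
proof -
  have 1: "fps_l1 (binom_fps b) \<le> 2" if "0 \<le> b" "b \<le> 1" for b
  proof -
    have "fps_l1 ((1 - fps_X) * binom_fps (b - 1)) \<le> ennreal (2 * binom_fps (b - 1) $ 0)"
      using that by (intro fps_l1_one_minus_X_mult_le binom_fps_nth_nonneg binom_fps_nth_decreasing) auto
    then show ?thesis by (simp add: binom_fps_minus_1) (simp add: binom_fps_nth)
  qed
  have 2: "fps_l1 (binom_fps (b + real k)) < \<infinity>" if "0 \<le> b" "b \<le> 1" for b k
  proof (induction k)
    case 0
    show ?case using le_less_trans[OF 1[OF that], of \<infinity>] by simp
  next
    case (Suc k)
    have "fps_l1 (binom_fps (b + real (Suc k))) \<le> fps_l1 (1 - fps_X) * fps_l1 (binom_fps (b + real k))"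
      using fps_l1_mult[of "1 - fps_X" "binom_fps (b + real k)"] binom_fps_minus_1[of "b + real (Suc k)"]
      by simp
    also have "\<dots> \<le> 2 * fps_l1 (binom_fps (b + real k))"
      by (intro mult_right_mono fps_l1_one_minus_X) auto
    also have "\<dots> < \<infinity>" using Suc by (simp add: ennreal_mult_less_top)
    finally show ?case .
  qed
  have "0 \<le> a - of_int \<lfloor>a\<rfloor>" "a - of_int \<lfloor>a\<rfloor> \<le> 1" by linarith+
  from 2[OF this, of "nat \<lfloor>a\<rfloor>"] show ?thesis using assms by simp
qed

section \<open>The dilation quotient of a binomial series\<close>

text \<open>
  The series \<open>(1 - z\<^sup>M)\<^sup>a\<close>, which represents the fractional difference with step \<open>Mh\<close>.
\<close>

definition dilated_binom_fps :: "nat \<Rightarrow> real \<Rightarrow> real fps" where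
  "dilated_binom_fps M a = binom_fps a oo fps_X ^ M"

text \<open>
  The series \<open>((1 - z\<^sup>M) / (1 - z))\<^sup>a\<close>, the multiplier that turns the difference with step \<open>h\<close> into the
  one with step \<open>Mh\<close>. Its coefficients are a discrete fractional B-spline.
\<close>

definition binom_quotient_fps :: "nat \<Rightarrow> real \<Rightarrow> real fps" where
  "binom_quotient_fps M a = dilated_binom_fps M a * binom_fps (- a)"

lemma binom_quotient_fps_mult: "binom_quotient_fps M a * binom_fps a = dilated_binom_fps M a"
  using binom_fps_add[of "- a" a] by (simp add: binom_quotient_fps_def mult.assoc)

context
  fixes M :: nat
  assumes M: "M > 0"
begin

lemma dilated_binom_fps_nth:
  "dilated_binom_fps M a $ n = (if M dvd n then binom_fps a $ (n div M) else 0)"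
proof -
  have "dilated_binom_fps M a $ n = (\<Sum>i=0..n. binom_fps a $ i * (if n = M * i then 1 else 0))"
    by (simp add: dilated_binom_fps_def fps_compose_nth flip: power_mult)
  also have "\<dots> = (\<Sum>i=0..n. if i = n div M then (if M dvd n then binom_fps a $ i else 0) else 0)"
    using M by (intro sum.cong) auto
  also have "\<dots> = (if M dvd n then binom_fps a $ (n div M) else 0)"
    by (simp add: sum.delta)
  finally show ?thesis .
qed

lemma dilated_binom_fps_add:
  "dilated_binom_fps M (a + b) = dilated_binom_fps M a * dilated_binom_fps M b"
  using M by (simp add: dilated_binom_fps_def binom_fps_add fps_compose_mult_distrib)

lemma dilated_binom_fps_1: "dilated_binom_fps M 1 = 1 - fps_X ^ M"
  using M by (simp add: dilated_binom_fps_def binom_fps_1 fps_compose_sub_distrib)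

lemma fps_deriv_dilated_binom_fps:
  "fps_deriv (dilated_binom_fps M a) =
     - fps_const a * dilated_binom_fps M (a - 1) * (of_nat M * fps_X ^ (M - 1))"
  using M by (simp add: dilated_binom_fps_def fps_compose_deriv fps_deriv_binom_fps
      fps_compose_mult_distrib fps_deriv_power fps_of_nat mult.assoc fps_compose_uminus)

lemma binom_quotient_fps_add:
  "binom_quotient_fps M (a + b) = binom_quotient_fps M a * binom_quotient_fps M b"
  using binom_fps_add[of "- a" "- b"]
  by (simp add: binom_quotient_fps_def dilated_binom_fps_add mult_ac)

text \<open>
  The ramp \<open>0, 1, \<dots>, M - 1, 0, 0, \<dots>\<close> arises from the logarithmic derivative of
  \<open>(1 - z\<^sup>M) / (1 - z)\<close>, which is the ramp times \<open>(1 - z)\<close> divided by \<open>z (1 - z\<^sup>M)\<close>.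
\<close>

definition ramp_fps :: "real fps" where
  "ramp_fps = (\<Sum>i<M. of_nat i * fps_X ^ i)"

lemma ramp_fps_nth: "ramp_fps $ n = (if n < M then real n else 0)"
proof -
  have "ramp_fps $ n = (\<Sum>i<M. if n = i then real i else 0)"
    unfolding ramp_fps_def fps_sum_nth by (intro sum.cong) (simp_all flip: fps_of_nat)
  then show ?thesis by simp
qed

lemma ramp_fps_times_square:
  "ramp_fps * (1 - fps_X)\<^sup>2 = fps_X * (1 - fps_X ^ M) - of_nat M * fps_X ^ M * (1 - fps_X)"
  unfolding ramp_fps_def
  by (induction M) (simp_all add: algebra_simps power2_eq_square)

text \<open>
  The operator \<open>z d/dz\<close> multiplies the \<open>n\<close>-th coefficient by \<open>n\<close>. The gain is that on the right hand
  side the dilated series has the exponent \<open>b - 1\<close>: for \<open>0 < b < 1\<close> its coefficients have one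
  sign and decay, while the series itself has coefficients that cancel.
\<close>

lemma fps_X_mult_deriv_binom_quotient:
  "fps_X * fps_deriv (binom_quotient_fps M b) =
     fps_const b * (dilated_binom_fps M (b - 1) * (ramp_fps * binom_fps (1 - b)))"
proof -
  define A D where "A = binom_fps (- b - 1)" and "D = dilated_binom_fps M (b - 1)"
  have 1: "binom_fps (- b) = (1 - fps_X) * A"
    using binom_fps_minus_1[of "- b"] by (simp add: A_def)
  have 2: "binom_fps (1 - b) = (1 - fps_X)\<^sup>2 * A"
    using binom_fps_minus_1[of "1 - b"] 1 by (simp add: power2_eq_square mult.assoc)
  have 3: "dilated_binom_fps M b = (1 - fps_X ^ M) * D"
    using dilated_binom_fps_add[of 1 "b - 1"] by (simp add: dilated_binom_fps_1 D_def)
  have 4: "fps_deriv (binom_quotient_fps M b) = dilated_binom_fps M b * (fps_const b * A) +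
      - fps_const b * D * (of_nat M * fps_X ^ (M - 1)) * binom_fps (- b)"
    unfolding binom_quotient_fps_def fps_deriv_mult fps_deriv_dilated_binom_fps fps_deriv_binom_fps
    by (simp add: A_def D_def)
  have "fps_X * fps_deriv (binom_quotient_fps M b) =
      fps_const b * D * A * (fps_X * (1 - fps_X ^ M) -
        of_nat M * (fps_X * fps_X ^ (M - 1)) * (1 - fps_X))"
    unfolding 4 1 3 by (simp add: algebra_simps del: fps_const_neg)
  also have "fps_X * fps_X ^ (M - 1) = (fps_X ^ M :: real fps)"
    using M by (simp flip: power_Suc)
  also have "fps_X * (1 - fps_X ^ M) - of_nat M * fps_X ^ M * (1 - fps_X) = ramp_fps * (1 - fps_X)\<^sup>2"
    by (rule ramp_fps_times_square[symmetric])
  finally show ?thesis unfolding 2 D_def by (simp only: mult_ac)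
qed

lemma fps_l1_ramp: "fps_l1 ramp_fps \<le> ennreal (real M ^ 2)"
proof -
  have "fps_l1 ramp_fps = (\<Sum>n<M. ennreal \<bar>ramp_fps $ n\<bar>)"
    unfolding fps_l1_def by (rule suminf_finite) (auto simp: ramp_fps_nth)
  also have "\<dots> \<le> ennreal (\<Sum>n<M. real M)"
    by (simp only: sum_ennreal abs_ge_zero) (auto intro!: ennreal_leI sum_mono simp: ramp_fps_nth simp del: sum_constant)
  finally show ?thesis by (simp add: power2_eq_square)
qed

lemma fps_l1_one_minus_X_ramp: "fps_l1 ((1 - fps_X) * ramp_fps) \<le> ennreal (2 * real M)"
proof -
  have "fps_l1 ((1 - fps_X) * ramp_fps) = (\<Sum>n\<le>M. ennreal \<bar>((1 - fps_X) * ramp_fps) $ n\<bar>)"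
    unfolding fps_l1_def
    by (rule suminf_finite) (auto simp: ramp_fps_nth fps_one_minus_X_mult_nth)
  also have "\<dots> \<le> ennreal (\<Sum>n\<le>M. if n = M then real M else 1)"
    by (simp only: sum_ennreal abs_ge_zero)
       (auto intro!: ennreal_leI sum_mono simp: ramp_fps_nth fps_one_minus_X_mult_nth simp del: sum_constant)
  also have "(\<Sum>n\<le>M. if n = M then real M else 1) = 2 * real M"
    by (simp add: lessThan_Suc_atMost[symmetric])
  finally show ?thesis .
qed

end

lemma summable_Suc_powr: "0 < b \<Longrightarrow> summable (\<lambda>k. real (Suc k) powr (- b - 1))"
  using summable_real_powr_iff[of "- b - 1"] summable_Suc_iff[of "\<lambda>k. real k powr (- b - 1)"]
  by simp

context
  fixes M :: nat
  assumes M: "M > 0"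
begin

text \<open>
  The coefficients of \<open>(1 - z)\<close> to the power \<open>-b\<close> below \<open>M\<close> serve twice: they are the coefficients
  of the quotient below \<open>M\<close>, and they form the head in the splitting used for the ramp.
\<close>

lemma fps_l1_head_binom_fps:
  assumes "0 < b" "b < 1"
  shows "fps_l1 (Abs_fps (\<lambda>n. if n < M then binom_fps (- b) $ n else 0)) \<le> ennreal (real M powr b / b)"
proof -
  have "fps_l1 (Abs_fps (\<lambda>n. if n < M then binom_fps (- b) $ n else 0)) =
      (\<Sum>n<M. ennreal \<bar>binom_fps (- b) $ n\<bar>)"
    unfolding fps_l1_def by (subst suminf_finite[of "{..<M}"]) auto
  also have "\<dots> = ennreal (\<Sum>n<M. \<bar>binom_fps (- b) $ n\<bar>)" by simp
  also have "\<dots> \<le> ennreal (\<Sum>n<M. real (Suc n) powr (- (1 - b)))"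
    using assms binom_fps_nth_le[of "1 - b"] binom_fps_nth_nonneg[of "1 - b"]
    by (intro ennreal_leI sum_mono) simp
  also have "\<dots> \<le> ennreal (real M powr b / b)"
    using sum_powr_le[of "1 - b" M] assms by (intro ennreal_leI) simp
  finally show ?thesis .
qed

text \<open>
  The ramp has norm of order \<open>M\<^sup>2\<close>, its difference only norm of order \<open>M\<close>; a difference of the
  fractional order \<open>1 - b\<close> lies in between. Write \<open>(1 - z)\<close> to the power \<open>1 - b\<close> as
  \<open>(1 - z) U\<close> and split \<open>U\<close> at the index \<open>M\<close>: for the head the factor \<open>1 - z\<close> is given to the ramp,
  for the tail to \<open>U\<close>, whose coefficients decrease.
\<close>

lemma fps_l1_ramp_mult_binom_fps:
  assumes b: "0 < b" "b < 1"
  shows "fps_l1 (ramp_fps M * binom_fps (1 - b)) \<le> ennreal ((2 / b + 2) * real M powr (1 + b))"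
proof -
  define U where "U = binom_fps (- b)"
  define U1 U2 where "U1 = Abs_fps (\<lambda>n. if n < M then U $ n else 0)"
    and "U2 = Abs_fps (\<lambda>n. if n < M then 0 else U $ n)"
  have U: "0 \<le> U $ n" "U $ Suc n \<le> U $ n" "U $ n \<le> real (Suc n) powr (b - 1)" for n
    using b binom_fps_nth_nonneg[of "1 - b" n] binom_fps_nth_decreasing[of "1 - b" n]
      binom_fps_nth_le[of "1 - b" n] by (auto simp: U_def)
  have "U = U1 + U2" by (simp add: fps_eq_iff U1_def U2_def)
  then have "binom_fps (1 - b) = (1 - fps_X) * (U1 + U2)"
    using binom_fps_minus_1[of "1 - b"] by (simp add: U_def)
  then have "ramp_fps M * binom_fps (1 - b) =
      (1 - fps_X) * ramp_fps M * U1 + ramp_fps M * ((1 - fps_X) * U2)"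
    by (simp only:) (simp add: algebra_simps)
  also have "fps_l1 \<dots> \<le> fps_l1 ((1 - fps_X) * ramp_fps M) * fps_l1 U1 +
      fps_l1 (ramp_fps M) * fps_l1 ((1 - fps_X) * U2)"
    by (intro order_trans[OF fps_l1_add] add_mono fps_l1_mult)
  also have "\<dots> \<le> ennreal (2 * real M) * ennreal (real M powr b / b) +
      ennreal (real M ^ 2) * ennreal (2 * real M powr (b - 1))"
  proof (intro add_mono mult_mono)
    have "fps_l1 ((1 - fps_X) * U2) \<le> ennreal (2 * U2 $ M)"
      using U by (intro fps_l1_one_minus_X_mult_le) (auto simp: U2_def)
    also have "U2 $ M \<le> real (Suc M) powr (b - 1)" using U(3)[of M] by (simp add: U2_def)
    also have "real (Suc M) powr (b - 1) \<le> real M powr (b - 1)"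
      using M b by (intro powr_mono2') auto
    finally show "fps_l1 ((1 - fps_X) * U2) \<le> ennreal (2 * real M powr (b - 1))"
      by (simp add: ennreal_leI)
    show "fps_l1 U1 \<le> ennreal (real M powr b / b)"
      unfolding U1_def U_def by (rule fps_l1_head_binom_fps[OF b])
  qed (use M fps_l1_ramp fps_l1_one_minus_X_ramp in auto)
  also have "\<dots> = ennreal (2 * real M * (real M powr b / b) + real M ^ 2 * (2 * real M powr (b - 1)))"
    using b by (simp flip: ennreal_plus ennreal_mult)
  also have "2 * real M * (real M powr b / b) + real M ^ 2 * (2 * real M powr (b - 1)) =
      (2 / b + 2) * real M powr (1 + b)"
  proof -
    have "real M powr (1 + b) = real M * real M powr b"
      using M by (simp add: powr_add)
    moreover have "real M ^ 2 * real M powr (b - 1) = real M * real M powr b"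
      using M by (simp add: powr_diff power2_eq_square)
    ultimately show ?thesis by (simp add: algebra_simps)
  qed
  finally show ?thesis .
qed

text \<open>
  Only the indices \<open>i = kM\<close> contribute, with coefficient at most \<open>k + 1\<close> to the power \<open>-b\<close>, and
  the division by \<open>max i M \<ge> (k + 1) M / 2\<close> makes them summable and supplies the factor \<open>1/M\<close>.
\<close>

lemma suminf_dilated_binom_fps_weighted:
  assumes b: "0 < b" "b < 1"
  shows "(\<Sum>i. ennreal (\<bar>dilated_binom_fps M (b - 1) $ i\<bar> / real (max i M)))
      \<le> ennreal (2 * (\<Sum>k. real (Suc k) powr (- b - 1)) / real M)"
proof -
  have "(\<Sum>i. ennreal (\<bar>dilated_binom_fps M (b - 1) $ i\<bar> / real (max i M))) =
      (\<Sum>i. if M dvd i then ennreal (\<bar>binom_fps (b - 1) $ (i div M)\<bar> / real (max (i div M * M) M)) else 0)"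
    by (intro suminf_cong) (simp add: dilated_binom_fps_nth[OF M])
  also have "\<dots> = (\<Sum>k. ennreal (\<bar>binom_fps (b - 1) $ k\<bar> / real (max (k * M) M)))"
    using suminf_ennreal_multiples[OF M, of "\<lambda>k. ennreal (\<bar>binom_fps (b - 1) $ k\<bar> / real (max (k * M) M))"]
    by simp
  also have "\<dots> \<le> (\<Sum>k. ennreal (2 / real M * real (Suc k) powr (- b - 1)))"
  proof (intro suminf_le ennreal_leI)
    fix k
    have "real (Suc k) * real M \<le> 2 * real (max (k * M) M)"
      using M by (auto simp: max_def algebra_simps)
    moreover have "0 < real (Suc k) * real M" using M by simp
    ultimately have "2 / (2 * real (max (k * M) M)) \<le> 2 / (real (Suc k) * real M)"
      by (intro divide_left_mono) auto
    then have *: "1 / real (max (k * M) M) \<le> 2 / (real (Suc k) * real M)" by simp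
    have "\<bar>binom_fps (b - 1) $ k\<bar> \<le> real (Suc k) powr (- b)"
      using b binom_fps_nth_le[of b k] binom_fps_nth_nonneg[of b k] by simp
    with * have "\<bar>binom_fps (b - 1) $ k\<bar> * (1 / real (max (k * M) M))
        \<le> real (Suc k) powr (- b) * (2 / (real (Suc k) * real M))"
      by (intro mult_mono) auto
    also have "\<dots> = 2 / real M * real (Suc k) powr (- b - 1)"
      by (simp add: powr_diff field_simps del: of_nat_Suc)
    finally show "\<bar>binom_fps (b - 1) $ k\<bar> / real (max (k * M) M) \<le> 2 / real M * real (Suc k) powr (- b - 1)"
      by simp
  qed auto
  also have "\<dots> = ennreal (\<Sum>k. 2 / real M * real (Suc k) powr (- b - 1))"
  proof (intro suminf_ennreal2)
    show "summable (\<lambda>k. 2 / real M * real (Suc k) powr (- b - 1))"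
      using b by (intro summable_mult summable_Suc_powr)
  qed auto
  also have "(\<Sum>k. 2 / real M * real (Suc k) powr (- b - 1)) = 2 / real M * (\<Sum>k. real (Suc k) powr (- b - 1))"
    using b by (intro suminf_mult summable_Suc_powr)
  finally show ?thesis by simp
qed

text \<open>
  Below \<open>M\<close> the coefficients of the quotient \<open>c\<close> are those of \<open>(1 - z)\<close> to the power \<open>-b\<close>. From \<open>M\<close>
  on, divide the differential equation by \<open>n\<close>. In the convolution on its right hand side
  \<open>1/n \<le> 1/max i M\<close> for each index \<open>i \<le> n\<close> of the dilated factor, so the tail is bounded by a product
  of two norms, of order \<open>1/M\<close> and of order \<open>M\<close> to the power \<open>1 + b\<close>.
\<close>

lemma fps_l1_binom_quotient_less_1:
  assumes b: "0 < b" "b < 1"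
  shows "fps_l1 (binom_quotient_fps M b) \<le>
    ennreal ((1 / b + 4 * (1 + b) * (\<Sum>k. real (Suc k) powr (- b - 1))) * real M powr b)"
proof -
  define c Q E S where "c = binom_quotient_fps M b" and "Q = dilated_binom_fps M (b - 1)"
    and "E = ramp_fps M * binom_fps (1 - b)" and "S = (\<Sum>k. real (Suc k) powr (- b - 1))"
  have S: "0 \<le> S" unfolding S_def
    using b by (intro suminf_nonneg summable_Suc_powr) auto
  define w where "w i = ennreal (\<bar>Q $ i\<bar> / real (max i M))" for i
  have head: "c $ n = binom_fps (- b) $ n" if "n < M" for n
  proof -
    have "c $ n = (\<Sum>i=0..n. dilated_binom_fps M b $ i * binom_fps (- b) $ (n - i))"
      by (simp add: c_def binom_quotient_fps_def fps_mult_nth)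
    also have "\<dots> = (\<Sum>i=0..n. if i = 0 then binom_fps (- b) $ (n - i) else 0)"
      using that by (intro sum.cong) (auto simp: dilated_binom_fps_nth[OF M] binom_fps_nth dest: dvd_imp_le)
    also have "\<dots> = binom_fps (- b) $ n" by simp
    finally show ?thesis .
  qed
  have tail: "ennreal \<bar>c $ n\<bar> \<le> ennreal b * (\<Sum>i\<le>n. w i * ennreal \<bar>E $ (n - i)\<bar>)" if "M \<le> n" for n
  proof -
    have n: "0 < real n" using that M by simp
    have "real n * c $ n = (fps_X * fps_deriv c) $ n"
      using n by (simp add: of_nat_Suc[symmetric] del: of_nat_Suc)
    also have "\<dots> = b * (\<Sum>i\<le>n. Q $ i * E $ (n - i))"
      unfolding c_def fps_X_mult_deriv_binom_quotient[OF M] fps_mult_left_const_nth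
      by (simp add: fps_mult_nth Q_def E_def atMost_atLeast0)
    finally have "\<bar>real n * c $ n\<bar> = \<bar>b * (\<Sum>i\<le>n. Q $ i * E $ (n - i))\<bar>"
      by (rule arg_cong)
    then have "\<bar>c $ n\<bar> = b * \<bar>\<Sum>i\<le>n. Q $ i * E $ (n - i)\<bar> / real n"
      using n b by (simp add: abs_mult nonzero_eq_divide_eq mult.commute)
    also have "\<dots> \<le> b * (\<Sum>i\<le>n. \<bar>Q $ i\<bar> * \<bar>E $ (n - i)\<bar>) / real n"
      using b n by (intro divide_right_mono mult_left_mono order_trans[OF sum_abs]) (auto simp: abs_mult)
    also have "\<dots> = b * (\<Sum>i\<le>n. \<bar>Q $ i\<bar> / real n * \<bar>E $ (n - i)\<bar>)"
      by (simp flip: sum_divide_distrib)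
    also have "\<dots> \<le> b * (\<Sum>i\<le>n. \<bar>Q $ i\<bar> / real (max i M) * \<bar>E $ (n - i)\<bar>)"
      using b n M that by (intro mult_left_mono sum_mono mult_right_mono divide_left_mono) auto
    finally have "ennreal \<bar>c $ n\<bar> \<le> ennreal (b * (\<Sum>i\<le>n. \<bar>Q $ i\<bar> / real (max i M) * \<bar>E $ (n - i)\<bar>))"
      by (rule ennreal_leI)
    then show ?thesis using b
      by (simp add: ennreal_mult sum_nonneg w_def del: times_divide_eq_left flip: sum_ennreal)
  qed
  have "fps_l1 c \<le> (\<Sum>n. ennreal \<bar>if n < M then binom_fps (- b) $ n else 0\<bar> +
      ennreal b * (\<Sum>i\<le>n. w i * ennreal \<bar>E $ (n - i)\<bar>))"
    unfolding fps_l1_def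
  proof (intro suminf_le)
    fix n
    show "ennreal \<bar>c $ n\<bar> \<le> ennreal \<bar>if n < M then binom_fps (- b) $ n else 0\<bar> +
      ennreal b * (\<Sum>i\<le>n. w i * ennreal \<bar>E $ (n - i)\<bar>)"
      using head[of n] tail[of n] by (cases "n < M") auto
  qed auto
  also have "\<dots> = fps_l1 (Abs_fps (\<lambda>n. if n < M then binom_fps (- b) $ n else 0)) +
      ennreal b * (\<Sum>n. \<Sum>i\<le>n. w i * ennreal \<bar>E $ (n - i)\<bar>)"
    by (subst suminf_add[symmetric]) (auto simp: fps_l1_def)
  also have "(\<Sum>n. \<Sum>i\<le>n. w i * ennreal \<bar>E $ (n - i)\<bar>) = (\<Sum>i. w i) * fps_l1 E"
    using suminf_ennreal_Cauchy[of "\<lambda>i j. w i * ennreal \<bar>E $ j\<bar>"]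
    by (simp add: fps_l1_def)
  also have "fps_l1 (Abs_fps (\<lambda>n. if n < M then binom_fps (- b) $ n else 0)) + ennreal b * ((\<Sum>i. w i) * fps_l1 E)
      \<le> ennreal (real M powr b / b) +
        ennreal b * (ennreal (2 * S / real M) * ennreal ((2 / b + 2) * real M powr (1 + b)))"
    unfolding w_def Q_def E_def S_def
    by (intro add_mono mult_left_mono mult_mono fps_l1_head_binom_fps b fps_l1_ramp_mult_binom_fps
        suminf_dilated_binom_fps_weighted) auto
  also have "\<dots> = ennreal (real M powr b / b + b * (2 * S / real M * ((2 / b + 2) * real M powr (1 + b))))"
    using b S by (simp flip: ennreal_plus ennreal_mult)
  also have "real M powr b / b + b * (2 * S / real M * ((2 / b + 2) * real M powr (1 + b))) =
      (1 / b + 4 * (1 + b) * S) * real M powr b"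
    using b M by (simp add: powr_add field_simps)
  finally show ?thesis unfolding c_def S_def .
qed

lemma fps_l1_binom_quotient_1: "fps_l1 (binom_quotient_fps M 1) \<le> ennreal (real M)"
proof -
  have "(1 - fps_X) * (\<Sum>i<M. fps_X ^ i) = (1 - fps_X ^ M :: real fps)"
    by (rule one_diff_power_eq[symmetric])
  then have "binom_quotient_fps M 1 = (\<Sum>i<M. fps_X ^ i) * ((1 - fps_X) * binom_fps (- 1))"
    by (simp add: binom_quotient_fps_def dilated_binom_fps_1[OF M] mult_ac)
  also have "(1 - fps_X) * binom_fps (- 1) = 1" using binom_fps_minus_1[of 0] by simp
  finally have *: "binom_quotient_fps M 1 $ n = (if n < M then 1 else 0)" for n
    by (simp add: fps_sum_nth)
  have "fps_l1 (binom_quotient_fps M 1) = (\<Sum>n<M. ennreal \<bar>binom_quotient_fps M 1 $ n\<bar>)"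
    unfolding fps_l1_def by (rule suminf_finite) (auto simp: *)
  also have "\<dots> = ennreal (real M)" by (simp add: * ennreal_of_nat_eq_real_of_nat)
  finally show ?thesis by simp
qed

end

text \<open>
  The norm is submultiplicative, so the integer part of \<open>a\<close> contributes a power of the geometric
  sum, whose norm is \<open>M\<close>, and only the fractional part of \<open>a\<close> needs the differential equation.
\<close>

theorem fps_l1_binom_quotient:
  assumes "0 < a"
  shows "\<exists>C>0. \<forall>M>0. fps_l1 (binom_quotient_fps M a) \<le> ennreal (C * real M powr a)"
proof -
  have *: "\<exists>C>0. \<forall>M>0. fps_l1 (binom_quotient_fps M (b + real k)) \<le> ennreal (C * real M powr (b + real k))"
    if b: "0 \<le> b" "b < 1" for b k
  proof (induction k)
    case 0
    show ?case
    proof (cases "b = 0")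
      case True
      then show ?thesis
        using fps_l1_const[of 1]
        by (intro exI[of _ 1]) (auto simp: binom_quotient_fps_def dilated_binom_fps_def)
    next
      case False
      define C where "C = 1 / b + 4 * (1 + b) * (\<Sum>k. real (Suc k) powr (- b - 1))"
      have "0 \<le> (\<Sum>k. real (Suc k) powr (- b - 1))"
        using b False by (intro suminf_nonneg summable_Suc_powr) auto
      then have "C > 0" using b False unfolding C_def by (intro add_pos_nonneg) auto
      then show ?thesis
        using fps_l1_binom_quotient_less_1[of _ b] b False by (intro exI[of _ C]) (auto simp: C_def)
    qed
  next
    case (Suc k)
    then obtain C where C: "C > 0"
      "\<And>M. M > 0 \<Longrightarrow> fps_l1 (binom_quotient_fps M (b + real k)) \<le> ennreal (C * real M powr (b + real k))"
      by blast
    have "fps_l1 (binom_quotient_fps M (b + real (Suc k))) \<le> ennreal (C * real M powr (b + real (Suc k)))"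
      if M: "M > 0" for M
    proof -
      have "fps_l1 (binom_quotient_fps M (b + real k + 1)) \<le>
          fps_l1 (binom_quotient_fps M (b + real k)) * fps_l1 (binom_quotient_fps M 1)"
        unfolding binom_quotient_fps_add[OF M, of "b + real k" 1] by (rule fps_l1_mult)
      also have "\<dots> \<le> ennreal (C * real M powr (b + real k)) * ennreal (real M)"
        by (intro mult_mono C fps_l1_binom_quotient_1 M) auto
      also have "\<dots> = ennreal (C * real M powr (b + real k + 1))"
        using C(1) M by (simp add: powr_add mult.assoc flip: ennreal_mult)
      finally show ?thesis by (simp add: algebra_simps)
    qed
    with C(1) show ?case by blast
  qed
  have "0 \<le> a - of_int \<lfloor>a\<rfloor>" "a - of_int \<lfloor>a\<rfloor> < 1" by linarith+
  from *[OF this, of "nat \<lfloor>a\<rfloor>"] show ?thesis using assms by simp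
qed

section \<open>Rearrangement of series and Jensen's inequality\<close>

lemma suminf_swap_absolute:
  fixes g :: "nat \<Rightarrow> nat \<Rightarrow> complex"
  assumes fin: "(\<Sum>n. \<Sum>i. ennreal (norm (g n i))) < \<infinity>"
  shows "(\<Sum>n. \<Sum>i. g n i) = (\<Sum>i. \<Sum>n. g n i)"
proof -
  have fin': "(\<Sum>i. \<Sum>n. ennreal (norm (g n i))) < top"
    using fin suminf_ennreal_swap[of "\<lambda>n i. ennreal (norm (g n i))"] by simp
  have row: "(\<Sum>i. ennreal (norm (g n i))) \<noteq> \<infinity>" for n
    using ennreal_suminf_lessD[OF fin[unfolded infinity_ennreal_def], of n] by simp
  have col: "(\<Sum>n. ennreal (norm (g n i))) \<noteq> \<infinity>" for i
    using ennreal_suminf_lessD[OF fin', of i] by simp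
  have sr: "summable (\<lambda>i. norm (g n i))" for n
    using row[of n] by (intro summable_suminf_not_top) auto
  have sc: "summable (\<lambda>n. norm (g n i))" for i
    using col[of i] by (intro summable_suminf_not_top) auto
  have srs: "summable (\<lambda>n. \<Sum>i. norm (g n i))"
  proof (rule summable_suminf_not_top)
    have "(\<Sum>n. ennreal (\<Sum>i. norm (g n i))) = (\<Sum>n. \<Sum>i. ennreal (norm (g n i)))"
      using row by (intro suminf_cong) simp
    then show "(\<Sum>n. ennreal (\<Sum>i. norm (g n i))) \<noteq> top" using fin by simp
  qed (auto intro: suminf_nonneg sr)
  have scs: "summable (\<lambda>i. norm (\<Sum>n. g n i))"
  proof (rule summable_suminf_not_top)
    have "(\<Sum>i. ennreal (norm (\<Sum>n. g n i))) \<le> (\<Sum>i. \<Sum>n. ennreal (norm (g n i)))"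
      using col sc by (intro suminf_le) (auto intro!: ennreal_leI summable_norm)
    then show "(\<Sum>i. ennreal (norm (\<Sum>n. g n i))) \<noteq> top" using fin' by (auto simp: top_unique)
  qed auto
  have "(\<Sum>n. \<Sum>i. g n i) = (\<Sum>n. \<integral>i. g n i \<partial>count_space UNIV)"
    using sr by (intro suminf_cong integral_count_space_nat[symmetric]) (simp add: integrable_count_space_nat_iff)
  also have "\<dots> = (\<integral>i. (\<Sum>n. g n i) \<partial>count_space UNIV)"
    using sr sc srs
    by (intro integral_suminf[symmetric])
       (auto simp: integrable_count_space_nat_iff AE_count_space integral_count_space_nat)
  also have "\<dots> = (\<Sum>i. \<Sum>n. g n i)"
    using scs by (intro integral_count_space_nat) (simp add: integrable_count_space_nat_iff)
  finally show ?thesis .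
qed

lemma suminf_Cauchy_absolute:
  fixes f :: "nat \<Rightarrow> nat \<Rightarrow> complex"
  assumes fin: "(\<Sum>i. \<Sum>j. ennreal (norm (f i j))) < \<infinity>"
  shows "(\<Sum>n. \<Sum>i\<le>n. f i (n - i)) = (\<Sum>i. \<Sum>j. f i j)"
proof -
  define g where "g n i = (if i \<le> n then f i (n - i) else 0)" for n i
  have finite: "(\<Sum>i. g n i) = (\<Sum>i\<le>n. f i (n - i))" for n
  proof -
    have "(\<Sum>i. g n i) = (\<Sum>i\<le>n. g n i)" by (rule suminf_finite) (auto simp: g_def)
    then show ?thesis by (simp add: g_def)
  qed
  have "(\<Sum>i. ennreal (norm (g n i))) = (\<Sum>i\<le>n. ennreal (norm (f i (n - i))))" for n
  proof -
    have "(\<Sum>i. ennreal (norm (g n i))) = (\<Sum>i\<le>n. ennreal (norm (g n i)))"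
      by (rule suminf_finite) (auto simp: g_def)
    then show ?thesis by (simp add: g_def)
  qed
  then have "(\<Sum>n. \<Sum>i. ennreal (norm (g n i))) < \<infinity>"
    using fin suminf_ennreal_Cauchy[of "\<lambda>i j. ennreal (norm (f i j))"] by simp
  then have "(\<Sum>n. \<Sum>i. g n i) = (\<Sum>i. \<Sum>n. g n i)" by (rule suminf_swap_absolute)
  moreover have "(\<Sum>n. g n i) = (\<Sum>j. f i j)" for i
  proof -
    have "(\<Sum>k. ennreal (norm (f i k))) \<noteq> top"
      using ennreal_suminf_lessD[OF fin[unfolded infinity_ennreal_def], of i] by simp
    then have "summable (\<lambda>k. norm (f i k))" by (intro summable_suminf_not_top) auto
    then have "summable (\<lambda>k. f i k)" by (rule summable_norm_cancel)
    then have "summable (\<lambda>k. g (k + i) i)" by (simp add: g_def)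
    then have "(\<Sum>n. g n i) = (\<Sum>k. g (k + i) i) + (\<Sum>n<i. g n i)" by (rule suminf_offset)
    then show ?thesis by (simp add: g_def)
  qed
  ultimately show ?thesis by (simp add: finite)
qed

text \<open>
  Summing the tangent line inequality for \<open>x \<mapsto> x\<^sup>p\<close> at the weighted mean \<open>\<mu>\<close> gives the estimate, and at
  \<open>1\<close> it gives the summability of the left hand side.
\<close>

lemma Jensen_powr_suminf:
  fixes w x :: "nat \<Rightarrow> real"
  assumes p: "1 \<le> p" and w: "\<And>j. 0 \<le> w j" "summable w" and x: "\<And>j. 0 \<le> x j"
    and s: "summable (\<lambda>j. w j * x j powr p)"
  shows "summable (\<lambda>j. w j * x j)"
    and "(\<Sum>j. w j * x j) powr p \<le> (\<Sum>j. w j) powr (p - 1) * (\<Sum>j. w j * x j powr p)"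
proof -
  \<comment> \<open>The tangent of the convex function \<open>y powr p\<close> at \<open>\<mu>\<close>, divided by \<open>p\<close>.\<close>
  have tangent: "\<mu> powr (p - 1) * y \<le> y powr p / p + (1 - 1 / p) * \<mu> powr p" if "0 < \<mu>" "0 \<le> y" for \<mu> y :: real
  proof (cases "y = 0")
    case True
    have "0 \<le> (1 - 1 / p) * \<mu> powr p" using p by (intro mult_nonneg_nonneg) auto
    then show ?thesis using True by simp
  next
    case False
    with that have "y > 0" by simp
    have "(y powr p) powr (1 / p) * (\<mu> powr p) powr (1 - 1 / p) \<le> 1 / p * y powr p + (1 - 1 / p) * \<mu> powr p"
      using p that \<open>y > 0\<close> by (intro Youngs_inequality_0) auto
    moreover have "(y powr p) powr (1 / p) = y" "(\<mu> powr p) powr (1 - 1 / p) = \<mu> powr (p - 1)"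
      using p \<open>y > 0\<close> by (auto simp: powr_powr algebra_simps)
    ultimately show ?thesis by (simp add: mult.commute)
  qed
  have le: "x j \<le> x j powr p / p + (1 - 1 / p)" for j
    using tangent[of 1 "x j"] x by simp
  show sx: "summable (\<lambda>j. w j * x j)"
  proof (rule summable_comparison_test')
    show "summable (\<lambda>j. w j * x j powr p / p + w j * (1 - 1 / p))"
      by (intro summable_add summable_divide s summable_mult2 w)
    fix j
    show "norm (w j * x j) \<le> w j * x j powr p / p + w j * (1 - 1 / p)"
      using mult_left_mono[OF le w(1), of j j] w x by (simp add: algebra_simps)
  qed
  define S W where "S = (\<Sum>j. w j * x j)" and "W = (\<Sum>j. w j)"
  have S: "0 \<le> S" unfolding S_def using sx w x by (intro suminf_nonneg) auto
  have W: "0 \<le> W" unfolding W_def using w by (intro suminf_nonneg) auto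
  have T: "0 \<le> (\<Sum>j. w j * x j powr p)" using s w by (intro suminf_nonneg) auto
  show "S powr p \<le> W powr (p - 1) * (\<Sum>j. w j * x j powr p)"
  proof (cases "S = 0")
    case True
    then show ?thesis using T by simp
  next
    case False
    then have "S > 0" using S by simp
    have "W \<noteq> 0"
    proof
      assume "W = 0"
      then have "w j = 0" for j
        using suminf_eq_zero_iff[OF w(2) w(1)] by (simp add: W_def)
      then show False using \<open>S > 0\<close> by (simp add: S_def)
    qed
    then have "W > 0" using W by simp
    define \<mu> where "\<mu> = S / W"
    have \<mu>: "\<mu> > 0" "S = W * \<mu>" using \<open>S > 0\<close> \<open>W > 0\<close> by (auto simp: \<mu>_def)
    have "(\<Sum>j. \<mu> powr (p - 1) * (w j * x j)) \<le> (\<Sum>j. w j * x j powr p / p + w j * ((1 - 1 / p) * \<mu> powr p))"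
    proof (rule suminf_le)
      fix j
      show "\<mu> powr (p - 1) * (w j * x j) \<le> w j * x j powr p / p + w j * ((1 - 1 / p) * \<mu> powr p)"
        using mult_left_mono[OF tangent[OF \<mu>(1) x] w(1), of j j] by (simp add: algebra_simps)
    qed (intro summable_add summable_divide s summable_mult summable_mult2 w sx)+
    also have "\<dots> = (\<Sum>j. w j * x j powr p) / p + W * ((1 - 1 / p) * \<mu> powr p)"
      unfolding W_def
      by (subst suminf_add[symmetric]) (auto intro!: summable_divide summable_mult2 s w simp: suminf_divide[OF s] suminf_mult2[OF w(2), symmetric])
    also have "(\<Sum>j. \<mu> powr (p - 1) * (w j * x j)) = \<mu> powr (p - 1) * S"
      unfolding S_def by (rule suminf_mult[OF sx])
    also have "\<mu> powr (p - 1) * S = W * \<mu> powr p"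
      using \<mu> by (simp add: powr_diff)
    finally have "W * \<mu> powr p \<le> (\<Sum>j. w j * x j powr p)"
      using p by (simp add: field_simps)
    then have "W powr (p - 1) * (W * \<mu> powr p) \<le> W powr (p - 1) * (\<Sum>j. w j * x j powr p)"
      by (intro mult_left_mono) auto
    moreover have "W powr (p - 1) * (W * \<mu> powr p) = S powr p"
      using \<open>W > 0\<close> \<mu> by (simp add: powr_mult powr_diff)
    ultimately show ?thesis by simp
  qed
qed

section \<open>Power series of translations on Lebesgue spaces\<close>

lemma nn_integral_lborel_translate:
  fixes f :: "'a::euclidean_space \<Rightarrow> ennreal"
  assumes [measurable]: "f \<in> borel_measurable borel"
  shows "(\<integral>\<^sup>+x. f (x + c) \<partial>lborel) = (\<integral>\<^sup>+x. f x \<partial>lborel)"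
proof -
  have "(\<integral>\<^sup>+x. f x \<partial>distr lborel borel ((+) c)) = (\<integral>\<^sup>+x. f (c + x) \<partial>lborel)"
    by (rule nn_integral_distr) auto
  then show ?thesis by (simp add: lborel_distr_plus add.commute)
qed

lemma AE_lborel_translate:
  fixes P :: "'a::euclidean_space \<Rightarrow> bool"
  assumes "AE x in lborel. P x"
  shows "AE x in lborel. P (x + c)"
  using AE_distrD[of "(+) c" lborel borel P, unfolded lborel_distr_plus] assms
  by (simp add: add.commute)

text \<open>
  The action of a power series on functions in which the variable acts as the translation
  \<open>g \<mapsto> g(\<cdot> - h)\<close>.
\<close>

definition fps_shift_sum :: "real fps \<Rightarrow> 'a \<Rightarrow> ('a::real_vector \<Rightarrow> complex) \<Rightarrow> 'a \<Rightarrow> complex" where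
  "fps_shift_sum F h g x = (\<Sum>j. (F $ j) *\<^sub>R g (x - real j *\<^sub>R h))"

lemma borel_measurable_fps_shift_sum [measurable]:
  fixes g :: "'a::euclidean_space \<Rightarrow> complex"
  assumes [measurable]: "g \<in> borel_measurable borel"
  shows "fps_shift_sum F h g \<in> borel_measurable borel"
  unfolding fps_shift_sum_def[abs_def] by measurable

lemma fps_shift_sum_dilated:
  assumes "M > 0"
  shows "fps_shift_sum (dilated_binom_fps M a) h g x = fps_shift_sum (binom_fps a) (real M *\<^sub>R h) g x"
proof -
  have "fps_shift_sum (dilated_binom_fps M a) h g x =
      (\<Sum>k. (dilated_binom_fps M a $ (k * M)) *\<^sub>R g (x - real (k * M) *\<^sub>R h))"
    unfolding fps_shift_sum_def using assms
    by (intro suminf_mono_reindex[of "\<lambda>k. k * M", symmetric])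
       (auto simp: strict_mono_def dilated_binom_fps_nth[OF assms] dvd_def image_iff mult.commute)
  then show ?thesis using assms by (simp add: fps_shift_sum_def dilated_binom_fps_nth[OF assms])
qed

text \<open>
  A Borel function with finite \<open>L\<^sup>p\<close> norm. Borel rather than Lebesgue measurability makes the
  translates \<open>g(x - jh)\<close> jointly measurable in \<open>x\<close> and \<open>h\<close>.
\<close>

locale Lp_function =
  fixes p :: real and g :: "'a::euclidean_space \<Rightarrow> complex"
  assumes p: "1 \<le> p"
    and measurable_g [measurable]: "g \<in> borel_measurable borel"
    and finite: "(\<integral>\<^sup>+x. ennreal (norm (g x) powr p) \<partial>lborel) < \<infinity>"
begin

lemma nn_integral_weighted_translates:
  "(\<integral>\<^sup>+x. (\<Sum>j. ennreal (\<bar>F $ j\<bar> * norm (g (x - real j *\<^sub>R h)) powr p)) \<partial>lborel) =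
     fps_l1 F * (\<integral>\<^sup>+x. ennreal (norm (g x) powr p) \<partial>lborel)"
proof -
  have "(\<integral>\<^sup>+x. (\<Sum>j. ennreal (\<bar>F $ j\<bar> * norm (g (x - real j *\<^sub>R h)) powr p)) \<partial>lborel) =
      (\<Sum>j. \<integral>\<^sup>+x. ennreal \<bar>F $ j\<bar> * ennreal (norm (g (x + (- real j *\<^sub>R h))) powr p) \<partial>lborel)"
    by (subst nn_integral_suminf) (simp_all add: ennreal_mult)
  also have "\<dots> = (\<Sum>j. ennreal \<bar>F $ j\<bar> * (\<integral>\<^sup>+x. ennreal (norm (g x) powr p) \<partial>lborel))"
  proof (rule suminf_cong)
    fix j
    show "(\<integral>\<^sup>+x. ennreal \<bar>F $ j\<bar> * ennreal (norm (g (x + (- real j *\<^sub>R h))) powr p) \<partial>lborel) =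
      ennreal \<bar>F $ j\<bar> * (\<integral>\<^sup>+x. ennreal (norm (g x) powr p) \<partial>lborel)"
      by (subst nn_integral_cmult, measurable)
         (subst nn_integral_lborel_translate[of "\<lambda>x. ennreal (norm (g x) powr p)"], auto)
  qed
  finally show ?thesis by (simp add: fps_l1_def)
qed

lemma AE_summable_weighted_translates:
  assumes "fps_l1 F < \<infinity>"
  shows "AE x in lborel. summable (\<lambda>j. \<bar>F $ j\<bar> * norm (g (x - real j *\<^sub>R h)) powr p)"
proof -
  have "fps_l1 F * (\<integral>\<^sup>+x. ennreal (norm (g x) powr p) \<partial>lborel) < \<infinity>"
    using assms finite by (simp add: ennreal_mult_less_top)
  then have "AE x in lborel. (\<Sum>j. ennreal (\<bar>F $ j\<bar> * norm (g (x - real j *\<^sub>R h)) powr p)) \<noteq> \<infinity>"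
    by (intro nn_integral_noteq_infinite) (auto simp: nn_integral_weighted_translates)
  then show ?thesis
    by eventually_elim (rule summable_suminf_not_top, auto)
qed

text \<open>
  Young's inequality for a discrete convolution: Jensen's inequality holds pointwise for the weights
  \<open>|F\<^sub>j|\<close>, and the integral of each translate equals that of \<open>|g|\<^sup>p\<close>.
\<close>

lemma nn_integral_fps_shift_sum_le:
  assumes L: "fps_l1 F \<le> ennreal L" "0 \<le> L"
  shows "(\<integral>\<^sup>+x. ennreal (norm (fps_shift_sum F h g x) powr p) \<partial>lborel)
    \<le> ennreal (L powr p) * (\<integral>\<^sup>+x. ennreal (norm (g x) powr p) \<partial>lborel)"
proof -
  define S where "S x = (\<Sum>j. ennreal (\<bar>F $ j\<bar> * norm (g (x - real j *\<^sub>R h)) powr p))" for x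
  have F: "fps_l1 F < \<infinity>" using L(1) le_less_trans by fastforce
  have sF: "summable (\<lambda>j. \<bar>F $ j\<bar>)"
    using F by (intro summable_suminf_not_top) (auto simp: fps_l1_def)
  have "ennreal (\<Sum>j. \<bar>F $ j\<bar>) \<le> ennreal L"
    using L F unfolding fps_l1_def by (subst (asm) suminf_ennreal) (auto simp: fps_l1_def)
  then have W: "(\<Sum>j. \<bar>F $ j\<bar>) \<le> L" using L(2) by (simp add: ennreal_le_iff)
  have "(\<integral>\<^sup>+x. ennreal (norm (fps_shift_sum F h g x) powr p) \<partial>lborel) \<le>
      (\<integral>\<^sup>+x. ennreal (L powr (p - 1)) * S x \<partial>lborel)"
  proof (rule nn_integral_mono_AE)
    show "AE x in lborel. ennreal (norm (fps_shift_sum F h g x) powr p) \<le> ennreal (L powr (p - 1)) * S x"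
      using AE_summable_weighted_translates[OF F, of h]
    proof eventually_elim
      case (elim x)
      let ?v = "\<lambda>j. norm (g (x - real j *\<^sub>R h))"
      note J = Jensen_powr_suminf[OF p _ sF _ elim]
      have s: "summable (\<lambda>j. \<bar>F $ j\<bar> * ?v j)" by (rule J) auto
      have "norm (fps_shift_sum F h g x) \<le> (\<Sum>j. \<bar>F $ j\<bar> * ?v j)"
        unfolding fps_shift_sum_def using s
        by (intro order_trans[OF summable_norm]) auto
      then have "norm (fps_shift_sum F h g x) powr p \<le> (\<Sum>j. \<bar>F $ j\<bar> * ?v j) powr p"
        using p by (intro powr_mono2) auto
      also have "\<dots> \<le> (\<Sum>j. \<bar>F $ j\<bar>) powr (p - 1) * (\<Sum>j. \<bar>F $ j\<bar> * ?v j powr p)"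
        by (rule J) auto
      also have "\<dots> \<le> L powr (p - 1) * (\<Sum>j. \<bar>F $ j\<bar> * ?v j powr p)"
        using W p sF by (intro mult_right_mono powr_mono2 suminf_nonneg elim) auto
      finally have "ennreal (norm (fps_shift_sum F h g x) powr p) \<le>
          ennreal (L powr (p - 1) * (\<Sum>j. \<bar>F $ j\<bar> * ?v j powr p))" by (rule ennreal_leI)
      also have "\<dots> = ennreal (L powr (p - 1)) * S x"
        unfolding S_def using elim by (subst suminf_ennreal2) (auto simp: ennreal_mult suminf_nonneg)
      finally show ?case .
    qed
  qed
  also have "\<dots> = ennreal (L powr (p - 1)) * (\<integral>\<^sup>+x. S x \<partial>lborel)"
    unfolding S_def by (rule nn_integral_cmult) measurable
  also have "(\<integral>\<^sup>+x. S x \<partial>lborel) = fps_l1 F * (\<integral>\<^sup>+x. ennreal (norm (g x) powr p) \<partial>lborel)"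
    unfolding S_def by (rule nn_integral_weighted_translates)
  also have "ennreal (L powr (p - 1)) * \<dots> \<le>
      ennreal (L powr (p - 1)) * (ennreal L * (\<integral>\<^sup>+x. ennreal (norm (g x) powr p) \<partial>lborel))"
    by (intro mult_left_mono mult_right_mono L) auto
  also have "\<dots> = ennreal (L powr (p - 1) * L) * (\<integral>\<^sup>+x. ennreal (norm (g x) powr p) \<partial>lborel)"
    using L by (simp add: ennreal_mult mult.assoc)
  also have "L powr (p - 1) * L = L powr p"
    using L(2) p by (cases "L = 0") (auto simp: powr_diff)
  finally show ?thesis .
qed

text \<open>
  Where the double series converges absolutely it may be summed along antidiagonals. The product of
  the series of moduli is again absolutely summable, so this happens almost everywhere.
\<close>

lemma AE_fps_shift_sum_mult:
  assumes F: "fps_l1 F < \<infinity>" and G: "fps_l1 G < \<infinity>"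
  shows "AE x in lborel. fps_shift_sum (F * G) h g x = fps_shift_sum F h (fps_shift_sum G h g) x"
proof -
  define H where "H = Abs_fps (\<lambda>n. \<bar>F $ n\<bar>) * Abs_fps (\<lambda>n. \<bar>G $ n\<bar>)"
  have H_nth: "H $ n = (\<Sum>i\<le>n. \<bar>F $ i\<bar> * \<bar>G $ (n - i)\<bar>)" for n
    by (simp add: H_def fps_mult_nth atMost_atLeast0)
  have H_nonneg: "0 \<le> H $ n" for n by (simp add: H_nth sum_nonneg)
  have "fps_l1 H \<le> fps_l1 F * fps_l1 G"
    using fps_l1_mult[of "Abs_fps (\<lambda>n. \<bar>F $ n\<bar>)" "Abs_fps (\<lambda>n. \<bar>G $ n\<bar>)"]
    by (simp add: H_def fps_l1_def)
  then have H: "fps_l1 H < \<infinity>"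
    using F G by (auto simp: ennreal_mult_less_top intro: le_less_trans)
  have sH: "summable (\<lambda>j. H $ j)"
    using H H_nonneg by (intro summable_suminf_not_top) (auto simp: fps_l1_def)
  show ?thesis
    using AE_summable_weighted_translates[OF H, of h]
  proof eventually_elim
    case (elim x)
    define v where "v n = g (x - real n *\<^sub>R h)" for n
    have "summable (\<lambda>n. H $ n * norm (v n))"
      using Jensen_powr_suminf(1)[OF p H_nonneg sH, of "\<lambda>n. norm (v n)"] elim H_nonneg
      by (simp add: v_def)
    then have "(\<Sum>n. ennreal (H $ n * norm (v n))) \<noteq> top"
      using H_nonneg by (intro ennreal_suminf_neq_top) auto
    also have "(\<Sum>n. ennreal (H $ n * norm (v n))) =
        (\<Sum>n. \<Sum>i\<le>n. ennreal (norm ((F $ i * G $ (n - i)) *\<^sub>R v (i + (n - i)))))"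
      by (intro suminf_cong) (simp add: H_nth sum_distrib_right abs_mult)
    also have "\<dots> = (\<Sum>i. \<Sum>j. ennreal (norm ((F $ i * G $ j) *\<^sub>R v (i + j))))"
      by (rule suminf_ennreal_Cauchy)
    finally have fin: "(\<Sum>i. \<Sum>j. ennreal (norm ((F $ i * G $ j) *\<^sub>R v (i + j)))) < \<infinity>"
      by (simp add: less_top)
    have "fps_shift_sum (F * G) h g x = (\<Sum>n. \<Sum>i\<le>n. (F $ i * G $ (n - i)) *\<^sub>R v (i + (n - i)))"
      unfolding fps_shift_sum_def
      by (intro suminf_cong) (simp add: fps_mult_nth atMost_atLeast0 scaleR_sum_left v_def)
    also have "\<dots> = (\<Sum>i. \<Sum>j. (F $ i * G $ j) *\<^sub>R v (i + j))"
      by (rule suminf_Cauchy_absolute[OF fin])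
    also have "\<dots> = (\<Sum>i. (F $ i) *\<^sub>R (\<Sum>j. (G $ j) *\<^sub>R v (i + j)))"
    proof (rule suminf_cong)
      fix i
      show "(\<Sum>j. (F $ i * G $ j) *\<^sub>R v (i + j)) = (F $ i) *\<^sub>R (\<Sum>j. (G $ j) *\<^sub>R v (i + j))"
      proof (cases "F $ i = 0")
        case False
        have "(\<Sum>j. ennreal (norm ((F $ i * G $ j) *\<^sub>R v (i + j)))) \<noteq> top"
          using ennreal_suminf_lessD[OF fin[unfolded infinity_ennreal_def], of i] by simp
        then have "summable (\<lambda>j. norm ((F $ i * G $ j) *\<^sub>R v (i + j)))"
          by (intro summable_suminf_not_top) auto
        then have "summable (\<lambda>j. (F $ i * G $ j) *\<^sub>R v (i + j))" by (rule summable_norm_cancel)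
        then have "summable (\<lambda>j. (F $ i) *\<^sub>R ((G $ j) *\<^sub>R v (i + j)))" by simp
        then have "summable (\<lambda>j. inverse (F $ i) *\<^sub>R ((F $ i) *\<^sub>R ((G $ j) *\<^sub>R v (i + j))))"
          by (rule summable_scaleR_right)
        then have "summable (\<lambda>j. (G $ j) *\<^sub>R v (i + j))" using False by (simp flip: mult.assoc)
        from suminf_scaleR_right[OF this, of "F $ i"] show ?thesis by simp
      qed simp
    qed
    also have "\<dots> = fps_shift_sum F h (fps_shift_sum G h g) x"
      by (simp add: fps_shift_sum_def v_def algebra_simps)
    finally show ?case .
  qed
qed

end

section \<open>The modulus of the fractional difference\<close>

text \<open>
  The translation by \<open>ah\<close> does not change integrals over the whole space, so norms of the
  fractional difference are norms of the binomial series applied to \<open>f\<close>.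
\<close>

lemma frac_diff_eq_fps_shift_sum:
  "frac_diff a h f x = fps_shift_sum (binom_fps a) h f (x + a *\<^sub>R h)"
  unfolding frac_diff_def fps_shift_sum_def
  by (intro suminf_cong) (simp add: binom_fps_nth algebra_simps)

text \<open>
  The \<open>p\<close>-th power of the \<open>L\<^sup>p\<close> norm of \<open>\<Delta>\<^sub>h\<^sup>a f\<close>, with the translation by \<open>ah\<close> left out.
\<close>

definition frac_modulus :: "real \<Rightarrow> real \<Rightarrow> ('a::euclidean_space \<Rightarrow> complex) \<Rightarrow> 'a \<Rightarrow> ennreal" where
  "frac_modulus p a f h = (\<integral>\<^sup>+x. ennreal (norm (fps_shift_sum (binom_fps a) h f x) powr p) \<partial>lborel)"

lemma borel_measurable_frac_modulus [measurable]:
  fixes f :: "'a::euclidean_space \<Rightarrow> complex"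
  assumes [measurable]: "f \<in> borel_measurable borel"
  shows "frac_modulus p a f \<in> borel_measurable borel"
  unfolding frac_modulus_def[abs_def] fps_shift_sum_def by measurable

lemma frac_modulus_bound:
  assumes "0 \<le> a"
  shows "\<exists>C\<ge>0. \<forall>g :: 'a::euclidean_space \<Rightarrow> complex. Lp_function p g \<longrightarrow>
    (\<forall>h. frac_modulus p a g h \<le> ennreal C * (\<integral>\<^sup>+x. ennreal (norm (g x) powr p) \<partial>lborel))"
proof -
  define L where "L = enn2real (fps_l1 (binom_fps a))"
  have L: "fps_l1 (binom_fps a) \<le> ennreal L" "0 \<le> L"
    using fps_l1_binom_fps_finite[OF assms] by (auto simp: L_def)
  show ?thesis
    unfolding frac_modulus_def
    using Lp_function.nn_integral_fps_shift_sum_le[OF _ L]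
    by (intro exI[of _ "L powr p"]) auto
qed

text \<open>
  Almost everywhere, the difference with step \<open>Mh\<close> is the quotient series applied to the difference
  with step \<open>h\<close>; the norm of the quotient series is at most a multiple of \<open>M\<^sup>a\<close>.
\<close>

lemma frac_modulus_dilate:
  assumes a: "0 < a"
  shows "\<exists>C>0. \<forall>g :: 'a::euclidean_space \<Rightarrow> complex. Lp_function p g \<longrightarrow>
    (\<forall>M>0. \<forall>h. frac_modulus p a g (real M *\<^sub>R h) \<le> ennreal (C * real M powr (a * p)) * frac_modulus p a g h)"
proof -
  obtain C where C: "C > 0" "\<And>M. M > 0 \<Longrightarrow> fps_l1 (binom_quotient_fps M a) \<le> ennreal (C * real M powr a)"
    using fps_l1_binom_quotient[OF a] by blast
  have "frac_modulus p a g (real M *\<^sub>R h) \<le> ennreal (C powr p * real M powr (a * p)) * frac_modulus p a g h"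
    if g: "Lp_function p g" and M: "M > 0" for g :: "'a \<Rightarrow> complex" and M h
  proof -
    interpret g: Lp_function p g by (rule g)
    define d where "d = fps_shift_sum (binom_fps a) h g"
    define L where "L = enn2real (fps_l1 (binom_fps a))"
    have finite: "fps_l1 (binom_fps a) < \<infinity>" using a by (intro fps_l1_binom_fps_finite) auto
    then have L: "fps_l1 (binom_fps a) \<le> ennreal L" "0 \<le> L" by (auto simp: L_def)
    interpret d: Lp_function p d
    proof
      show "1 \<le> p" by (rule g.p)
      show "d \<in> borel_measurable borel" unfolding d_def by measurable
      have "(\<integral>\<^sup>+x. ennreal (norm (d x) powr p) \<partial>lborel) \<le>
          ennreal (L powr p) * (\<integral>\<^sup>+x. ennreal (norm (g x) powr p) \<partial>lborel)"
        unfolding d_def by (rule g.nn_integral_fps_shift_sum_le[OF L])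
      also have "\<dots> < \<infinity>" using g.finite by (simp add: ennreal_mult_less_top)
      finally show "(\<integral>\<^sup>+x. ennreal (norm (d x) powr p) \<partial>lborel) < \<infinity>" .
    qed
    have quotient_finite: "fps_l1 (binom_quotient_fps M a) < \<infinity>"
      using le_less_trans[OF C(2)[OF M], of \<infinity>] by simp
    have ae: "AE x in lborel. fps_shift_sum (binom_fps a) (real M *\<^sub>R h) g x =
        fps_shift_sum (binom_quotient_fps M a) h d x"
      using g.AE_fps_shift_sum_mult[OF quotient_finite finite, of h]
      by (simp add: binom_quotient_fps_mult fps_shift_sum_dilated[OF M] d_def)
    have "frac_modulus p a g (real M *\<^sub>R h) =
        (\<integral>\<^sup>+x. ennreal (norm (fps_shift_sum (binom_quotient_fps M a) h d x) powr p) \<partial>lborel)"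
      unfolding frac_modulus_def by (rule nn_integral_cong_AE) (use ae in eventually_elim, simp)
    also have "\<dots> \<le> ennreal ((C * real M powr a) powr p) * (\<integral>\<^sup>+x. ennreal (norm (d x) powr p) \<partial>lborel)"
      using C M by (intro d.nn_integral_fps_shift_sum_le) auto
    also have "(C * real M powr a) powr p = C powr p * real M powr (a * p)"
      using C(1) M by (simp add: powr_mult powr_powr)
    finally show ?thesis by (simp add: frac_modulus_def d_def)
  qed
  with C(1) show ?thesis by (intro exI[of _ "C powr p"]) auto
qed

section \<open>Integrals with a power weight\<close>

lemma nn_integral_lborel_scale:
  fixes f :: "'a::euclidean_space \<Rightarrow> ennreal"
  assumes [measurable]: "f \<in> borel_measurable borel" and c: "0 < c"
  shows "(\<integral>\<^sup>+x. f x \<partial>lborel) = ennreal (c ^ DIM('a)) * (\<integral>\<^sup>+x. f (c *\<^sub>R x) \<partial>lborel)"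
proof -
  have "(\<integral>\<^sup>+x. f x \<partial>lborel) =
      (\<integral>\<^sup>+x. f x \<partial>density (distr lborel borel (\<lambda>x. 0 + c *\<^sub>R x)) (\<lambda>_. ennreal (\<bar>c\<bar> ^ DIM('a))))"
    using lborel_affine[of c "0::'a"] c by simp
  also have "\<dots> = ennreal (c ^ DIM('a)) * (\<integral>\<^sup>+x. f (c *\<^sub>R x) \<partial>lborel)"
    using c by (simp add: nn_integral_density nn_integral_distr nn_integral_cmult)
  finally show ?thesis .
qed

lemma term_le_suminf_ennreal: "f n \<le> (\<Sum>i. f i :: ennreal)"
  using sum_le_suminf[OF summableI, of "{n}" f] by simp

lemma one_minus_exp_minus_ge:
  fixes x :: real
  assumes "0 < x"
  shows "x / (1 + x) \<le> 1 - exp (- x)"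
proof -
  have "1 + x \<le> exp x" by (rule exp_ge_add_one_self)
  then have "exp (- x) \<le> 1 / (1 + x)"
    using assms by (simp add: exp_minus field_simps)
  then show ?thesis using assms by (simp add: field_simps)
qed

lemma two_powr_minus: "2 powr (- x) = exp (- (x * ln 2))" for x :: real
  by (simp add: powr_def)

text \<open>
  On the dyadic shell from \<open>2\<^sup>N\<close> to \<open>2\<^sup>N\<^sup>+\<^sup>1\<close> the weight is at most its value on the inner sphere, and
  the shell lies in a ball of volume proportional to \<open>2\<^sup>(\<^sup>N\<^sup>+\<^sup>1\<^sup>)\<^sup>d\<close>. The resulting geometric series has the
  sum \<open>1 / (1 - 2\<^sup>-\<^sup>q)\<close>, which has the correct order \<open>1/q\<close> for small \<open>q\<close>.
\<close>

lemma nn_integral_norm_powr_outside_unit_ball: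
  fixes q :: real
  assumes q: "0 < q"
  shows "(\<integral>\<^sup>+h. ennreal (norm h powr (- (q + DIM('a)))) * indicator (- ball (0::'a::euclidean_space) 1) h \<partial>lborel)
    \<le> ennreal (2 ^ DIM('a) * measure lborel (ball (0::'a) 1) * (1 + 1 / (q * ln 2)))"
proof -
  let ?d = "real DIM('a)"
  define c where "c N = 2 powr (- (real N * (q + ?d)))" for N
  have c: "0 \<le> c N" for N by (simp add: c_def)
  have [measurable]: "ball (0::'a) r \<in> sets borel" for r by simp
  define V where "V = measure lborel (ball (0::'a) 1)"
  have "(\<integral>\<^sup>+h. ennreal (norm h powr (- (q + ?d))) * indicator (- ball (0::'a) 1) h \<partial>lborel) \<le>
      (\<integral>\<^sup>+h. (\<Sum>N. ennreal (c N) * indicator (ball (0::'a) (2 ^ Suc N)) h) \<partial>lborel)"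
  proof (rule nn_integral_mono)
    fix h :: 'a
    show "ennreal (norm h powr (- (q + ?d))) * indicator (- ball (0::'a) 1) h \<le>
      (\<Sum>N. ennreal (c N) * indicator (ball (0::'a) (2 ^ Suc N)) h)"
    proof (cases "norm h < 1")
      case False
      define N where "N = nat \<lfloor>log 2 (norm h)\<rfloor>"
      have r: "1 \<le> norm h" using False by simp
      then have "0 < norm h" by linarith
      then have "0 \<le> log 2 (norm h)" using r by (subst zero_le_log_cancel_iff) auto
      then have N: "real N \<le> log 2 (norm h)" "log 2 (norm h) < real (Suc N)"
        unfolding N_def by linarith+
      have "2 powr real N \<le> norm h" "norm h < 2 powr real (Suc N)"
        using N \<open>0 < norm h\<close> by (simp_all only: le_log_iff log_less_iff one_less_numeral_iff semiring_norm)
      then have N': "norm h < 2 ^ Suc N" "norm h powr (- (q + ?d)) \<le> (2 powr real N) powr (- (q + ?d))"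
        using q r by (auto simp: powr_realpow[symmetric] simp del: of_nat_Suc power_Suc intro!: powr_mono2')
      have "ennreal (norm h powr (- (q + ?d))) * indicator (- ball (0::'a) 1) h \<le>
          ennreal (c N) * indicator (ball (0::'a) (2 ^ Suc N)) h"
      proof -
        have "indicator (- ball (0::'a) 1) h = (1::ennreal)" "indicator (ball (0::'a) (2 ^ Suc N)) h = (1::ennreal)"
          using N'(1) False by auto
        moreover have "norm h powr (- (q + ?d)) \<le> c N"
          using N'(2) by (simp only: powr_powr mult_minus_right c_def)
        ultimately show ?thesis by (simp add: ennreal_leI)
      qed
      also have "\<dots> \<le> (\<Sum>N. ennreal (c N) * indicator (ball (0::'a) (2 ^ Suc N)) h)"
        by (rule term_le_suminf_ennreal[where f = "\<lambda>N. ennreal (c N) * indicator (ball 0 (2 ^ Suc N)) h"])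
      finally show ?thesis .
    qed simp
  qed
  also have "\<dots> = (\<Sum>N. ennreal (c N) * emeasure lborel (ball (0::'a) (2 ^ Suc N)))"
    by (subst nn_integral_suminf, measurable) (simp add: nn_integral_cmult_indicator del: power_Suc)
  also have "\<dots> = (\<Sum>N. ennreal (2 ^ DIM('a) * V * (2 powr (- q)) ^ N))"
  proof (rule suminf_cong)
    fix N
    have "emeasure lborel (ball (0::'a) (2 ^ Suc N)) = ennreal (measure lborel (ball (0::'a) (2 ^ Suc N)))"
      by (rule emeasure_eq_ennreal_measure) (use emeasure_lborel_ball_finite in \<open>auto simp: less_top\<close>)
    also have "measure lborel (ball (0::'a) (2 ^ Suc N)) = (2 ^ Suc N) ^ DIM('a) * V"
      unfolding V_def by (rule content_ball_conv_unit_ball) simp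
    also have "ennreal (c N) * ennreal ((2 ^ Suc N) ^ DIM('a) * V) =
        ennreal (2 ^ DIM('a) * V * (2 powr (- q)) ^ N)"
    proof (subst ennreal_mult[symmetric])
      have "c N = (2 powr (- q)) ^ N * (1 / 2 ^ N) ^ DIM('a)"
      proof -
        have "c N = 2 powr (real N * (- q)) * 2 powr (- (real N * ?d))"
          by (simp only: c_def powr_add[symmetric]) (simp add: algebra_simps)
        also have "2 powr (real N * (- q)) = (2 powr (- q)) ^ N"
          by (subst powr_realpow[symmetric]) (simp_all add: powr_powr mult.commute)
        also have "2 powr (- (real N * ?d)) = (1 / 2 ^ N) ^ DIM('a)"
          using powr_realpow[of 2 "N * DIM('a)"]
          by (simp add: powr_minus power_mult field_simps power_one_over)
        finally show ?thesis .
      qed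
      then have "c N * (2 ^ Suc N) ^ DIM('a) = 2 ^ DIM('a) * (2 powr (- q)) ^ N"
        by (simp add: power_one_over power_mult_distrib)
      then show "ennreal (c N * ((2 ^ Suc N) ^ DIM('a) * V)) =
        ennreal (2 ^ DIM('a) * V * (2 powr (- q)) ^ N)"
        by (metis mult.assoc mult.commute)
    qed (auto simp: V_def c)
    finally show "ennreal (c N) * emeasure lborel (ball (0::'a) (2 ^ Suc N)) =
        ennreal (2 ^ DIM('a) * V * (2 powr (- q)) ^ N)" .
  qed
  also have "\<dots> = ennreal (2 ^ DIM('a) * V * (1 / (1 - 2 powr (- q))))"
  proof (rule suminf_ennreal_eq)
    have "2 powr (- q) < 1" using q by (simp add: powr_less_one)
    then have "(\<lambda>N. (2 powr (- q)) ^ N) sums (1 / (1 - 2 powr (- q)))"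
      by (intro geometric_sums) simp
    then show "(\<lambda>N. 2 ^ DIM('a) * V * (2 powr (- q)) ^ N) sums (2 ^ DIM('a) * V * (1 / (1 - 2 powr (- q))))"
      by (rule sums_mult)
  qed (auto simp: V_def)
  also have "\<dots> \<le> ennreal (2 ^ DIM('a) * V * (1 + 1 / (q * ln 2)))"
  proof (intro ennreal_leI mult_left_mono)
    have y: "0 < q * ln 2" using q by simp
    have swap: "1 / (y / (1 + y)) = 1 + 1 / y" if "0 < y" for y :: real
      using that by (simp add: add_divide_distrib)
    have "1 / (1 - 2 powr (- q)) \<le> 1 / (q * ln 2 / (1 + q * ln 2))"
      using one_minus_exp_minus_ge[OF y] y unfolding two_powr_minus
      by (intro divide_left_mono) (auto intro!: mult_pos_pos)
    also have "\<dots> = 1 + 1 / (q * ln 2)" by (rule swap[OF y])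
    finally show "1 / (1 - 2 powr (- q)) \<le> 1 + 1 / (q * ln 2)" .
  qed (auto simp: V_def)
  finally show ?thesis unfolding V_def .
qed

text \<open>
  A geometric sum with ratio larger than \<open>1\<close> is comparable to its last term, and the last \<open>N\<close> with
  \<open>2\<^sup>N r < 1\<close> has \<open>2\<^sup>N\<^sup>e \<le> r\<^sup>-\<^sup>e\<close>. The right hand side is independent of the number of terms, so it
  bounds the infinite sum.
\<close>

lemma sum_geometric_below_threshold:
  fixes z r e :: real
  assumes e: "0 < e" and r: "0 < r"
  shows "(\<Sum>N<n. if 2 ^ N * r < 1 then (2 powr e) ^ N else 0) \<le> r powr (- e) / (1 - 2 powr (- e))"
proof (induction n)
  case 0
  have "2 powr (- e) \<le> 1" using e powr_mono[of "- e" 0 2] by simp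
  then show ?case by simp
next
  case (Suc n)
  define z where "z = 2 powr e"
  have z: "1 < z" "2 powr (- e) = 1 / z" using e by (auto simp: z_def powr_minus field_simps)
  show ?case
  proof (cases "2 ^ n * r < 1")
    case True
    have "(\<Sum>N<Suc n. if 2 ^ N * r < 1 then z ^ N else 0) = (\<Sum>N<Suc n. z ^ N)"
    proof (intro sum.cong)
      fix N assume "N \<in> {..<Suc n}"
      then have "2 ^ N * r \<le> 2 ^ n * r" using r by (intro mult_right_mono power_increasing) auto
      then show "(if 2 ^ N * r < 1 then z ^ N else 0) = z ^ N" using True by auto
    qed simp
    also have "\<dots> = (z ^ Suc n - 1) / (z - 1)" using z by (intro geometric_sum) auto
    also have "\<dots> \<le> z ^ Suc n / (z - 1)" using z by (intro divide_right_mono) auto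
    also have "\<dots> = z ^ n / (1 - 1 / z)" using z by (simp add: field_simps)
    also have "\<dots> \<le> r powr (- e) / (1 - 1 / z)"
    proof (intro divide_right_mono)
      have "2 ^ n \<le> 1 / r" using True r by (simp add: field_simps)
      then have "(2 ^ n) powr e \<le> (1 / r) powr e" using e by (intro powr_mono2) auto
      also have "(1 / r) powr e = r powr (- e)" using r by (simp add: powr_divide powr_minus field_simps)
      also have "(2 ^ n) powr e = z ^ n"
        unfolding z_def by (simp add: powr_realpow[symmetric] powr_powr mult.commute)
      finally show "z ^ n \<le> r powr (- e)" .
    qed (use z in auto)
    finally show ?thesis unfolding z_def[symmetric] z(2) .
  next
    case False
    then show ?thesis using Suc by simp
  qed
qed

text \<open>
  The comparison of the weighted integrals uses of \<open>\<Phi>\<close> only measurability and the growth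
  \<open>\<Phi>(Mh) \<le> K M\<^sup>a\<^sup>p \<Phi>(h)\<close> under dilations.
\<close>

locale scaled_modulus =
  fixes \<Phi> :: "'a::euclidean_space \<Rightarrow> ennreal" and a p K :: real
  assumes measurable_modulus [measurable]: "\<Phi> \<in> borel_measurable borel"
    and a: "0 < a" and p: "1 \<le> p" and K: "0 < K"
    and dilate: "\<And>M h. M > 0 \<Longrightarrow> \<Phi> (real M *\<^sub>R h) \<le> ennreal (K * real M powr (a * p)) * \<Phi> h"
begin

definition weighted_integral :: "real \<Rightarrow> ennreal" where
  "weighted_integral s = (\<integral>\<^sup>+h. \<Phi> h * ennreal (norm h powr (- (s * p + DIM('a)))) \<partial>lborel)"

definition inner_integral :: "real \<Rightarrow> ennreal" where
  "inner_integral s =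
     (\<integral>\<^sup>+h. \<Phi> h * ennreal (norm h powr (- (s * p + DIM('a)))) * indicator (ball 0 1) h \<partial>lborel)"

definition outer_integral :: "real \<Rightarrow> ennreal" where
  "outer_integral s =
     (\<integral>\<^sup>+h. \<Phi> h * ennreal (norm h powr (- (s * p + DIM('a)))) * indicator (- ball 0 1) h \<partial>lborel)"

lemma ball_borel [measurable]: "ball (0::'a) r \<in> sets borel"
  by simp

lemma weighted_integral_split: "weighted_integral s = inner_integral s + outer_integral s"
  unfolding weighted_integral_def inner_integral_def outer_integral_def
  by (subst nn_integral_add[symmetric]; (measurable)?)
     (auto intro!: nn_integral_cong simp: indicator_def)

lemma inner_integral_mono:
  assumes "s \<le> t"
  shows "inner_integral s \<le> inner_integral t"
  unfolding inner_integral_def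
proof (intro nn_integral_mono)
  fix h :: 'a
  have "norm h powr (- (s * p + DIM('a))) \<le> norm h powr (- (t * p + DIM('a)))" if "norm h < 1"
  proof (cases "h = 0")
    case False
    then show ?thesis using assms p that by (intro powr_mono') (auto intro: mult_right_mono)
  qed simp
  then show "\<Phi> h * ennreal (norm h powr (- (s * p + DIM('a)))) * indicator (ball 0 1) h
      \<le> \<Phi> h * ennreal (norm h powr (- (t * p + DIM('a)))) * indicator (ball 0 1) h"
    by (auto simp: indicator_def intro!: mult_left_mono ennreal_leI)
qed

text \<open>
  The integral of the weight behaves like \<open>1/s\<close> as \<open>s\<close> tends to \<open>0\<close>; the factor \<open>s\<close> compensates this.
\<close>

lemma outer_integral_le:
  assumes s: "0 < s" "s < a" and B: "\<And>h. \<Phi> h \<le> B"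
  shows "ennreal s * outer_integral s \<le>
    ennreal (2 ^ DIM('a) * measure lborel (ball (0::'a) 1) * (a + 1 / (p * ln 2))) * B"
proof -
  let ?V = "measure lborel (ball (0::'a) 1)"
  have "outer_integral s \<le>
      (\<integral>\<^sup>+h. B * (ennreal (norm h powr (- (s * p + DIM('a)))) * indicator (- ball (0::'a) 1) h) \<partial>lborel)"
    unfolding outer_integral_def mult.assoc by (intro nn_integral_mono mult_right_mono B) auto
  also have "\<dots> = B * (\<integral>\<^sup>+h. ennreal (norm h powr (- (s * p + DIM('a)))) * indicator (- ball (0::'a) 1) h \<partial>lborel)"
    by (rule nn_integral_cmult) measurable
  also have "\<dots> \<le> B * ennreal (2 ^ DIM('a) * ?V * (1 + 1 / (s * p * ln 2)))"
    using s p by (intro mult_left_mono nn_integral_norm_powr_outside_unit_ball) auto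
  finally have "ennreal s * outer_integral s \<le>
      ennreal s * (B * ennreal (2 ^ DIM('a) * ?V * (1 + 1 / (s * p * ln 2))))"
    by (rule mult_left_mono) simp
  also have "\<dots> = ennreal (s * (2 ^ DIM('a) * ?V * (1 + 1 / (s * p * ln 2)))) * B"
    using s p by (subst ennreal_mult) (auto simp: mult_ac)
  also have "\<dots> \<le> ennreal (2 ^ DIM('a) * ?V * (a + 1 / (p * ln 2))) * B"
  proof (intro mult_right_mono ennreal_leI)
    have "s * (1 + 1 / (s * p * ln 2)) = s + 1 / (p * ln 2)" using s p by (simp add: field_simps)
    also have "\<dots> \<le> a + 1 / (p * ln 2)" using s by simp
    finally have "2 ^ DIM('a) * ?V * (s * (1 + 1 / (s * p * ln 2))) \<le> 2 ^ DIM('a) * ?V * (a + 1 / (p * ln 2))"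
      by (rule mult_left_mono) simp
    then show "s * (2 ^ DIM('a) * ?V * (1 + 1 / (s * p * ln 2))) \<le> 2 ^ DIM('a) * ?V * (a + 1 / (p * ln 2))"
      by (simp add: mult_ac)
  qed simp
  finally show ?thesis .
qed

text \<open>
  Substitute \<open>h = 2\<^sup>N h'\<close>. The growth of \<open>\<Phi>\<close>, the weight and the Jacobian produce powers of \<open>2\<^sup>N\<close> whose
  exponents \<open>ap\<close>, \<open>-(a - e)p - d\<close> and \<open>d\<close> add up to \<open>ep\<close>, where \<open>d\<close> is the dimension.
\<close>

lemma inner_integral_dilate:
  "inner_integral (a - e) \<le> ennreal (K * 2 powr (real N * e * p)) *
     (\<integral>\<^sup>+h. \<Phi> h * ennreal (norm h powr (- ((a - e) * p + DIM('a)))) * indicator (ball 0 (1 / 2 ^ N)) h \<partial>lborel)"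
proof -
  let ?q = "- ((a - e) * p + DIM('a))"
  let ?c = "2 ^ N :: real"
  have "inner_integral (a - e) = ennreal (?c ^ DIM('a)) *
      (\<integral>\<^sup>+h. \<Phi> (?c *\<^sub>R h) * ennreal (norm (?c *\<^sub>R h) powr ?q) * indicator (ball 0 1) (?c *\<^sub>R h) \<partial>lborel)"
    unfolding inner_integral_def by (rule nn_integral_lborel_scale) (measurable, auto intro!: open_Collect_less continuous_intros)
  also have "\<dots> \<le> ennreal (?c ^ DIM('a)) * (\<integral>\<^sup>+h. ennreal (K * ?c powr (a * p) * ?c powr ?q) *
      (\<Phi> h * ennreal (norm h powr ?q) * indicator (ball 0 (1 / 2 ^ N)) h) \<partial>lborel)"
  proof (intro mult_left_mono nn_integral_mono)
    fix h :: 'a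
    have ind: "indicator (ball 0 1) (?c *\<^sub>R h) = (indicator (ball 0 (1 / 2 ^ N)) h :: ennreal)"
      by (auto simp: indicator_def field_simps)
    have "\<Phi> (?c *\<^sub>R h) \<le> ennreal (K * ?c powr (a * p)) * \<Phi> h"
      using dilate[of "2 ^ N" h] by simp
    moreover have "ennreal (norm (?c *\<^sub>R h) powr ?q) = ennreal (?c powr ?q) * ennreal (norm h powr ?q)"
      by (simp add: powr_mult flip: ennreal_mult)
    ultimately have "\<Phi> (?c *\<^sub>R h) * ennreal (norm (?c *\<^sub>R h) powr ?q) * indicator (ball 0 1) (?c *\<^sub>R h) \<le>
      (ennreal (K * ?c powr (a * p)) * \<Phi> h) * (ennreal (?c powr ?q) * ennreal (norm h powr ?q)) *
        indicator (ball 0 (1 / 2 ^ N)) h"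
      unfolding ind by (intro mult_right_mono) (auto intro: mult_right_mono)
    also have "\<dots> = ennreal (K * ?c powr (a * p) * ?c powr ?q) *
      (\<Phi> h * ennreal (norm h powr ?q) * indicator (ball 0 (1 / 2 ^ N)) h)"
      using K by (simp add: ennreal_mult mult_ac)
    finally show "\<Phi> (?c *\<^sub>R h) * ennreal (norm (?c *\<^sub>R h) powr ?q) * indicator (ball 0 1) (?c *\<^sub>R h) \<le> \<dots>" .
  qed auto
  also have "\<dots> = ennreal (?c ^ DIM('a)) * (ennreal (K * ?c powr (a * p) * ?c powr ?q) *
      (\<integral>\<^sup>+h. \<Phi> h * ennreal (norm h powr ?q) * indicator (ball 0 (1 / 2 ^ N)) h \<partial>lborel))"
    by (rule arg_cong[OF nn_integral_cmult]) measurable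
  also have "\<dots> = ennreal (?c ^ DIM('a) * (K * ?c powr (a * p) * ?c powr ?q)) *
      (\<integral>\<^sup>+h. \<Phi> h * ennreal (norm h powr ?q) * indicator (ball 0 (1 / 2 ^ N)) h \<partial>lborel)"
    using K by (simp add: ennreal_mult mult.assoc)
  also have "?c ^ DIM('a) * (K * ?c powr (a * p) * ?c powr ?q) = K * 2 powr (real N * e * p)"
  proof -
    have "?c ^ DIM('a) * (K * ?c powr (a * p) * ?c powr ?q) =
        K * (?c powr DIM('a) * ?c powr (a * p) * ?c powr ?q)"
      by (simp add: powr_realpow)
    also have "?c powr DIM('a) * ?c powr (a * p) * ?c powr ?q = ?c powr (e * p)"
      unfolding powr_add[symmetric] by (simp add: algebra_simps)
    also have "?c powr (e * p) = 2 powr (real N * e * p)"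
      using powr_powr[of 2 "real N" "e * p"] by (simp add: powr_realpow mult.assoc del: powr_powr)
    finally show ?thesis .
  qed
  finally show ?thesis .
qed

end

context scaled_modulus
begin

text \<open>
  Every \<open>N\<close> gives a bound for the left hand side by an integral over the ball of radius \<open>2\<^sup>-\<^sup>N\<close>.
  Average these bounds with the probability weights \<open>(1 - y) y\<^sup>N\<close>, where \<open>y\<close> is \<open>2\<close> to the power \<open>-dp\<close>. At a
  point \<open>h\<close> only the \<open>N\<close> with \<open>2\<^sup>N |h| < 1\<close> contribute, and weight times constant is geometric in \<open>N\<close> with ratio
  \<open>2\<close> to the power \<open>(e - d)p\<close>. The sum is of the order of \<open>|h|\<close> to the power \<open>-(e - d)p\<close>, which converts the
  weight of the exponent \<open>a - e\<close> into that of \<open>a - d\<close>. The normalization \<open>1 - y\<close> is the small factor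
  of order \<open>d\<close> that the uniform estimate requires.
\<close>

lemma inner_integral_average:
  assumes d: "0 < d" "d < e"
  shows "inner_integral (a - e) \<le>
    ennreal (K * (1 - 2 powr (- (d * p))) / (1 - 2 powr (- ((e - d) * p)))) * inner_integral (a - d)"
proof -
  let ?q = "\<lambda>e. - ((a - e) * p + DIM('a))"
  define y where "y = 2 powr (- (d * p))"
  have y: "0 < y" "y < 1"
    unfolding y_def using d p powr_less_mono[of "- (d * p)" 0 2] by (auto intro: mult_pos_pos)
  define c where "c N = K * (1 - y) * (2 powr ((e - d) * p)) ^ N" for N
  have c: "0 \<le> c N" for N using K y by (simp add: c_def)
  \<comment> \<open>The weight of index \<open>N\<close> times the constant of the bound of index \<open>N\<close>.\<close>
  have cN: "((1 - y) * y ^ N) * (K * 2 powr (real N * e * p)) = c N" for N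
  proof -
    have "y ^ N * 2 powr (real N * e * p) = (2 powr ((e - d) * p)) ^ N"
      unfolding y_def
      by (subst (1 2) powr_realpow[symmetric]) (simp_all add: powr_powr powr_add[symmetric] algebra_simps)
    then show ?thesis unfolding c_def by (simp add: mult_ac)
  qed
  have "inner_integral (a - e) = (\<Sum>N. ennreal ((1 - y) * y ^ N)) * inner_integral (a - e)"
  proof -
    have "(\<lambda>N. (1 - y) * y ^ N) sums ((1 - y) * (1 / (1 - y)))"
      using y by (intro sums_mult geometric_sums) auto
    then have "(\<Sum>N. ennreal ((1 - y) * y ^ N)) = ennreal ((1 - y) * (1 / (1 - y)))"
      using y by (intro suminf_ennreal_eq) auto
    then show ?thesis using y by simp
  qed
  also have "\<dots> = (\<Sum>N. ennreal ((1 - y) * y ^ N) * inner_integral (a - e))"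
    by simp
  also have "\<dots> \<le> (\<Sum>N. ennreal (c N) *
      (\<integral>\<^sup>+h. \<Phi> h * ennreal (norm h powr ?q e) * indicator (ball 0 (1 / 2 ^ N)) h \<partial>lborel))"
  proof (intro suminf_le)
    fix N
    have "ennreal ((1 - y) * y ^ N) * inner_integral (a - e) \<le> ennreal ((1 - y) * y ^ N) *
       (ennreal (K * 2 powr (real N * e * p)) *
        (\<integral>\<^sup>+h. \<Phi> h * ennreal (norm h powr ?q e) * indicator (ball 0 (1 / 2 ^ N)) h \<partial>lborel))"
      by (intro mult_left_mono inner_integral_dilate) auto
    also have "\<dots> = ennreal (c N) *
      (\<integral>\<^sup>+h. \<Phi> h * ennreal (norm h powr ?q e) * indicator (ball 0 (1 / 2 ^ N)) h \<partial>lborel)"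
      using y K by (subst cN[symmetric], subst ennreal_mult) (auto simp: mult.assoc)
    finally show "ennreal ((1 - y) * y ^ N) * inner_integral (a - e) \<le> \<dots>" .
  qed auto
  also have "\<dots> = (\<integral>\<^sup>+h. (\<Sum>N. ennreal (c N) *
      (\<Phi> h * ennreal (norm h powr ?q e) * indicator (ball 0 (1 / 2 ^ N)) h)) \<partial>lborel)"
    by (subst nn_integral_suminf, measurable) (intro suminf_cong nn_integral_cmult[symmetric], measurable)
  also have "\<dots> \<le> (\<integral>\<^sup>+h. ennreal (K * (1 - y) / (1 - 2 powr (- ((e - d) * p)))) *
      (\<Phi> h * ennreal (norm h powr ?q d) * indicator (ball 0 1) h) \<partial>lborel)"
  proof (intro nn_integral_mono)
    fix h :: 'a
    have "2 powr (- ((e - d) * p)) < 1"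
      using d p powr_less_mono[of "- ((e - d) * p)" 0 2] by (auto intro: mult_pos_pos)
    then have z: "0 < 1 - 2 powr (- ((e - d) * p))" by simp
    consider "h = 0" | "1 \<le> norm h" | "h \<noteq> 0" "norm h < 1" by linarith
    then show "(\<Sum>N. ennreal (c N) * (\<Phi> h * ennreal (norm h powr ?q e) * indicator (ball 0 (1 / 2 ^ N)) h)) \<le>
        ennreal (K * (1 - y) / (1 - 2 powr (- ((e - d) * p)))) *
          (\<Phi> h * ennreal (norm h powr ?q d) * indicator (ball 0 1) h)"
    proof cases
      case 2
      have "norm h \<ge> 1 / 2 ^ N" for N
        using 2 by (rule order_trans[rotated]) (simp add: field_simps)
      then show ?thesis by (simp add: not_less)
    next
      case 3
      let ?r = "norm h"
      have "(\<Sum>N. ennreal (c N) * indicator (ball 0 (1 / 2 ^ N)) h) \<le>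
          ennreal (K * (1 - y) * (?r powr (- ((e - d) * p)) / (1 - 2 powr (- ((e - d) * p)))))"
      proof (rule suminf_le_const)
        fix n
        have "(\<Sum>N<n. ennreal (c N) * indicator (ball 0 (1 / 2 ^ N)) h) =
            (\<Sum>N<n. ennreal (K * (1 - y) * (if 2 ^ N * ?r < 1 then (2 powr ((e - d) * p)) ^ N else 0)))"
          by (intro sum.cong) (auto simp: c_def indicator_def field_simps)
        also have "\<dots> = ennreal (K * (1 - y) * (\<Sum>N<n. if 2 ^ N * ?r < 1 then (2 powr ((e - d) * p)) ^ N else 0))"
          using K y by (subst sum_ennreal) (auto simp: sum_distrib_left)
        also have "\<dots> \<le> ennreal (K * (1 - y) * (?r powr (- ((e - d) * p)) / (1 - 2 powr (- ((e - d) * p)))))"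
          using K y d p 3 by (intro ennreal_leI mult_left_mono sum_geometric_below_threshold) auto
        finally show "(\<Sum>N<n. ennreal (c N) * indicator (ball 0 (1 / 2 ^ N)) h) \<le> \<dots>" .
      qed simp
      then have "(\<Sum>N. ennreal (c N) * indicator (ball 0 (1 / 2 ^ N)) h) * (\<Phi> h * ennreal (?r powr ?q e)) \<le>
          ennreal (K * (1 - y) * (?r powr (- ((e - d) * p)) / (1 - 2 powr (- ((e - d) * p))))) *
            (\<Phi> h * ennreal (?r powr ?q e))"
        by (rule mult_right_mono) simp
      also have "\<dots> = (ennreal (K * (1 - y) * (?r powr (- ((e - d) * p)) / (1 - 2 powr (- ((e - d) * p))))) *
            ennreal (?r powr ?q e)) * \<Phi> h" by (simp add: mult_ac)
      also have "ennreal (K * (1 - y) * (?r powr (- ((e - d) * p)) / (1 - 2 powr (- ((e - d) * p))))) *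
            ennreal (?r powr ?q e) =
          ennreal (K * (1 - y) * (?r powr (- ((e - d) * p)) / (1 - 2 powr (- ((e - d) * p)))) * ?r powr ?q e)"
        using K y z by (intro ennreal_mult[symmetric]) (auto intro!: mult_nonneg_nonneg divide_nonneg_nonneg)
      also have "K * (1 - y) * (?r powr (- ((e - d) * p)) / (1 - 2 powr (- ((e - d) * p)))) * ?r powr ?q e =
          K * (1 - y) / (1 - 2 powr (- ((e - d) * p))) * (?r powr (- ((e - d) * p)) * ?r powr ?q e)"
        by simp
      also have "?r powr (- ((e - d) * p)) * ?r powr ?q e = ?r powr ?q d"
        unfolding powr_add[symmetric] by (simp add: algebra_simps)
      also have "ennreal (K * (1 - y) / (1 - 2 powr (- ((e - d) * p))) * ?r powr ?q d) =
          ennreal (K * (1 - y) / (1 - 2 powr (- ((e - d) * p)))) * ennreal (?r powr ?q d)"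
        using K y z by (intro ennreal_mult) auto
      finally have "(\<Sum>N. ennreal (c N) * indicator (ball 0 (1 / 2 ^ N)) h) * (\<Phi> h * ennreal (?r powr ?q e)) \<le>
        ennreal (K * (1 - y) / (1 - 2 powr (- ((e - d) * p)))) * (\<Phi> h * ennreal (?r powr ?q d))"
        by (simp add: mult_ac)
      moreover have "(\<Sum>N. ennreal (c N) * (Y * indicator (ball 0 (1 / 2 ^ N)) h)) =
          (\<Sum>N. ennreal (c N) * indicator (ball 0 (1 / 2 ^ N)) h) * Y" for Y
        by (subst ennreal_suminf_multc[symmetric]) (simp only: mult_ac)
      moreover have "indicator (ball 0 1) h = (1::ennreal)" using 3 by simp
      ultimately show ?thesis by (simp only: mult_1_right)
    qed simp
  qed
  also have "\<dots> = ennreal (K * (1 - y) / (1 - 2 powr (- ((e - d) * p)))) * inner_integral (a - d)"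
    unfolding inner_integral_def by (rule nn_integral_cmult) measurable
  finally show ?thesis unfolding y_def .
qed

text \<open>
  In the averaged bound the numerator \<open>1 - y\<close> is at most a multiple of \<open>d\<close>. The condition \<open>2d \<le> e\<close>
  gives \<open>e - d \<ge> e/2\<close> and thus a denominator of order at least \<open>e\<close>, uniformly for \<open>e \<le> a\<close>.
\<close>

lemma inner_integral_gain:
  assumes d: "0 < d" "2 * d \<le> e" "e \<le> a"
  shows "ennreal e * inner_integral (a - e) \<le>
    ennreal (2 * K * (1 + a * p * ln 2)) * (ennreal d * inner_integral (a - d))"
proof -
  define w where "w = (e - d) * p * ln 2"
  have w: "e * p * ln 2 / 2 \<le> w" "0 < w" "w \<le> a * p * ln 2"
  proof -
    have "e / 2 * (p * ln 2) \<le> (e - d) * (p * ln 2)" using d p by (intro mult_right_mono) auto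
    then show "e * p * ln 2 / 2 \<le> w" by (simp add: w_def)
    show "0 < w" using d p by (simp add: w_def)
    show "w \<le> a * p * ln 2" unfolding w_def using d p by (intro mult_right_mono) auto
  qed
  have den: "e * p * ln 2 / (2 * (1 + a * p * ln 2)) \<le> 1 - 2 powr (- ((e - d) * p))"
  proof -
    have "e * p * ln 2 / (2 * (1 + a * p * ln 2)) = (e * p * ln 2 / 2) / (1 + a * p * ln 2)" by simp
    also have "\<dots> \<le> w / (1 + w)"
      using w by (intro frac_le) auto
    also have "\<dots> \<le> 1 - exp (- w)" using w by (intro one_minus_exp_minus_ge)
    finally show ?thesis by (simp add: two_powr_minus w_def)
  qed
  have pos: "0 < e * p * ln 2" "0 < 1 + a * p * ln 2" using d p a by (auto intro!: add_pos_pos)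
  have num: "1 - 2 powr (- (d * p)) \<le> d * p * ln 2"
    using exp_ge_add_one_self[of "- (d * p * ln 2)"] by (simp add: two_powr_minus)
  have ge0: "0 \<le> 1 - 2 powr (- (d * p))"
    using d p powr_mono[of "- (d * p)" 0 2] by simp
  have pos2: "0 < e * p * ln 2 / (2 * (1 + a * p * ln 2))" using pos by simp
  have "e * (K * (1 - 2 powr (- (d * p))) / (1 - 2 powr (- ((e - d) * p)))) \<le>
      e * (K * (d * p * ln 2) / (e * p * ln 2 / (2 * (1 + a * p * ln 2))))"
    using d p K num den ge0 pos2 by (intro mult_left_mono frac_le) auto
  also have "\<dots> = 2 * K * (1 + a * p * ln 2) * d"
    using d p by (simp add: field_simps)
  finally have coeff: "e * (K * (1 - 2 powr (- (d * p))) / (1 - 2 powr (- ((e - d) * p)))) \<le>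
      2 * K * (1 + a * p * ln 2) * d" .
  have "ennreal e * inner_integral (a - e) \<le> ennreal e *
      (ennreal (K * (1 - 2 powr (- (d * p))) / (1 - 2 powr (- ((e - d) * p)))) * inner_integral (a - d))"
    using d by (intro mult_left_mono inner_integral_average) auto
  also have "\<dots> = ennreal (e * (K * (1 - 2 powr (- (d * p))) / (1 - 2 powr (- ((e - d) * p))))) * inner_integral (a - d)"
  proof -
    have "0 \<le> K * (1 - 2 powr (- (d * p))) / (1 - 2 powr (- ((e - d) * p)))"
      using K ge0 den pos2 by (intro divide_nonneg_nonneg mult_nonneg_nonneg) auto
    then show ?thesis using d by (simp add: ennreal_mult mult.assoc del: times_divide_eq_right)
  qed
  also have "\<dots> \<le> ennreal (2 * K * (1 + a * p * ln 2) * d) * inner_integral (a - d)"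
    by (intro mult_right_mono ennreal_leI coeff) auto
  also have "\<dots> = ennreal (2 * K * (1 + a * p * ln 2)) * (ennreal d * inner_integral (a - d))"
    using K pos d by (subst ennreal_mult) (auto simp: mult.assoc)
  finally show ?thesis .
qed

text \<open>
  If the minima differ by more than the factor \<open>2\<close>, then \<open>min t (a - t)\<close> cannot be \<open>t\<close>, since
  \<open>t > s \<ge> min s (a - s)\<close>. Hence \<open>t\<close> is at least twice as close to \<open>a\<close> as \<open>s\<close> is, and the gain from
  averaging applies. Otherwise the monotonicity of the weights inside the unit ball suffices.
\<close>

lemma weighted_integral_compare:
  assumes B: "\<And>h. \<Phi> h \<le> B" and st: "0 < s" "s < t" "t < a"
  shows "ennreal (min s (a - s)) * weighted_integral s \<le>
    ennreal (2 ^ DIM('a) * measure lborel (ball (0::'a) 1) * (a + 1 / (p * ln 2))) * B +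
    ennreal (2 + 2 * K * (1 + a * p * ln 2)) * (ennreal (min t (a - t)) * weighted_integral t)"
proof -
  have outer: "ennreal (min s (a - s)) * outer_integral s \<le>
      ennreal (2 ^ DIM('a) * measure lborel (ball (0::'a) 1) * (a + 1 / (p * ln 2))) * B"
    using st by (intro order_trans[OF mult_right_mono outer_integral_le[OF _ _ B]] ennreal_leI) auto
  have K': "0 \<le> 2 * K * (1 + a * p * ln 2)" using K a p by (intro mult_nonneg_nonneg) auto
  have "ennreal (min s (a - s)) * inner_integral s \<le>
      ennreal (2 + 2 * K * (1 + a * p * ln 2)) * (ennreal (min t (a - t)) * inner_integral t)"
  proof (cases "min s (a - s) \<le> 2 * min t (a - t)")
    case True
    then have "ennreal (min s (a - s)) * inner_integral s \<le> ennreal (2 * min t (a - t)) * inner_integral t"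
      using st by (intro mult_mono ennreal_leI inner_integral_mono) auto
    also have "\<dots> = ennreal 2 * (ennreal (min t (a - t)) * inner_integral t)"
      using st by (subst ennreal_mult) (auto simp: mult.assoc)
    also have "\<dots> \<le> ennreal (2 + 2 * K * (1 + a * p * ln 2)) * (ennreal (min t (a - t)) * inner_integral t)"
      using K' by (intro mult_right_mono ennreal_leI) auto
    finally show ?thesis .
  next
    case False
    then have t: "min t (a - t) = a - t" "2 * (a - t) \<le> a - s"
      using st by (auto simp: min_def split: if_splits)
    have "ennreal (min s (a - s)) * inner_integral s \<le> ennreal (a - s) * inner_integral (a - (a - s))"
      by (auto intro!: mult_right_mono ennreal_leI)
    also have "\<dots> \<le> ennreal (2 * K * (1 + a * p * ln 2)) * (ennreal (a - t) * inner_integral (a - (a - t)))"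
      using st t by (intro inner_integral_gain) auto
    also have "\<dots> \<le> ennreal (2 + 2 * K * (1 + a * p * ln 2)) * (ennreal (min t (a - t)) * inner_integral t)"
      unfolding t(1) by (auto intro!: mult_right_mono ennreal_leI)
    finally show ?thesis .
  qed
  also have "\<dots> \<le> ennreal (2 + 2 * K * (1 + a * p * ln 2)) * (ennreal (min t (a - t)) * weighted_integral t)"
    by (intro mult_left_mono) (auto simp: weighted_integral_split[of t])
  finally show ?thesis
    using add_mono[OF outer] by (simp add: weighted_integral_split[of s] distrib_left add.commute)
qed

end

section \<open>Fractional powers of extended nonnegative reals\<close>

lemma ennreal_pow_mono:
  assumes "x \<le> y" "0 \<le> q"
  shows "ennreal_pow x q \<le> ennreal_pow y q"
  using assms by (cases x; cases y) (auto simp: ennreal_pow_def ennreal_leI powr_mono2 top_unique)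

lemma ennreal_pow_cmult:
  assumes "0 < c"
  shows "ennreal_pow (ennreal c * x) q = ennreal (c powr q) * ennreal_pow x q"
proof (cases x)
  case (real r)
  then show ?thesis using assms
    by (simp add: ennreal_pow_def powr_mult flip: ennreal_mult)
next
  case top
  then show ?thesis using assms by (simp add: ennreal_pow_def ennreal_mult_top)
qed

lemma powr_add_le_add_powr:
  fixes x y q :: real
  assumes "0 \<le> x" "0 \<le> y" "0 < q" "q \<le> 1"
  shows "(x + y) powr q \<le> x powr q + y powr q"
proof (cases "x + y = 0")
  case False
  then have s: "0 < x + y" using assms by simp
  have *: "z / (x + y) * (x + y) powr q \<le> z powr q" if "0 \<le> z" "z \<le> x + y" for z
  proof -
    have "z / (x + y) \<le> (z / (x + y)) powr q"
      using powr_mono'[of q 1 "z / (x + y)"] that s assms by simp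
    then have "z / (x + y) * (x + y) powr q \<le> (z / (x + y)) powr q * (x + y) powr q"
      by (intro mult_right_mono) auto
    also have "\<dots> = z powr q" using that s by (simp add: powr_divide)
    finally show ?thesis .
  qed
  have "(x + y) powr q = x / (x + y) * (x + y) powr q + y / (x + y) * (x + y) powr q"
    using s by (simp add: add_divide_distrib[symmetric] flip: distrib_right)
  then show ?thesis using *[of x] *[of y] assms by simp
qed (use assms in auto)

lemma ennreal_pow_add_le:
  assumes "0 < q" "q \<le> 1"
  shows "ennreal_pow (x + y) q \<le> ennreal_pow x q + ennreal_pow y q"
proof (cases x)
  case (real r)
  show ?thesis
  proof (cases y)
    case (real r')
    then show ?thesis using \<open>x = ennreal r\<close> \<open>0 \<le> r\<close> assms
      by (simp add: ennreal_pow_def ennreal_leI powr_add_le_add_powr flip: ennreal_plus)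
  qed (auto simp: ennreal_pow_def)
qed (auto simp: ennreal_pow_def)

text \<open>
  Passage from the estimate for \<open>p\<close>-th powers to the one for norms. It also covers infinite
  seminorms: if \<open>W'\<close> is infinite, so is the right hand side.
\<close>

lemma ennreal_pow_compare:
  assumes p: "1 \<le> p" and m: "0 < m" "0 < m'" and A: "0 \<le> A" "0 \<le> D"
    and le: "ennreal m * W \<le> ennreal A * N + ennreal D * (ennreal m' * W')"
  shows "ennreal_pow N (1 / p) + ennreal (m powr (1 / p)) * ennreal_pow W (1 / p) \<le>
    ennreal (1 + (1 + A + D) powr (1 / p)) *
      (ennreal_pow N (1 / p) + ennreal (m' powr (1 / p)) * ennreal_pow W' (1 / p))"
proof -
  let ?P = "\<lambda>x. ennreal_pow x (1 / p)"
  let ?L = "1 + A + D"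
  have "ennreal m * W \<le> ennreal ?L * N + ennreal ?L * (ennreal m' * W')"
    using A by (intro order_trans[OF le] add_mono mult_right_mono ennreal_leI) auto
  then have "?P (ennreal m * W) \<le> ?P (ennreal ?L * (N + ennreal m' * W'))"
    using p by (intro ennreal_pow_mono) (auto simp: distrib_left)
  also have "\<dots> = ennreal (?L powr (1 / p)) * ?P (N + ennreal m' * W')"
    using A by (intro ennreal_pow_cmult) auto
  also have "\<dots> \<le> ennreal (?L powr (1 / p)) * (?P N + ?P (ennreal m' * W'))"
    using p by (intro mult_left_mono ennreal_pow_add_le) auto
  finally have "?P N + ?P (ennreal m * W) \<le>
      (?P N + ?P (ennreal m' * W')) + ennreal (?L powr (1 / p)) * (?P N + ?P (ennreal m' * W'))"
    by (intro add_mono) auto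
  also have "\<dots> = ennreal (1 + ?L powr (1 / p)) * (?P N + ?P (ennreal m' * W'))"
    by (simp add: ennreal_plus distrib_right)
  finally show ?thesis using m by (simp add: ennreal_pow_cmult)
qed

section \<open>The seminorms as weighted integrals\<close>

lemma lebesgue_measurable_complex_borel_representative:
  fixes f :: "'a::euclidean_space \<Rightarrow> complex"
  assumes "f \<in> borel_measurable lebesgue"
  obtains g where "g \<in> borel_measurable borel" "AE x in lborel. f x = g x"
proof -
  have "(\<lambda>x. Re (f x)) \<in> borel_measurable lebesgue" "(\<lambda>x. Im (f x)) \<in> borel_measurable lebesgue"
    using assms by measurable
  then obtain u v where uv: "u \<in> borel_measurable lborel" "AE x in lborel. Re (f x) = u x"
    "v \<in> borel_measurable lborel" "AE x in lborel. Im (f x) = v x"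
    using completion_ex_borel_measurable_real by metis
  then have [measurable]: "u \<in> borel_measurable borel" "v \<in> borel_measurable borel" by simp_all
  show ?thesis
  proof
    have "(\<lambda>x. complex_of_real (u x) + \<i> * complex_of_real (v x)) \<in> borel_measurable borel"
      by measurable
    then show "(\<lambda>x. Complex (u x) (v x)) \<in> borel_measurable borel" by (simp add: Complex_eq)
    show "AE x in lborel. f x = Complex (u x) (v x)"
      using uv(2,4) by eventually_elim (simp add: complex_eq_iff)
  qed
qed

text \<open>
  For fixed \<open>h\<close> the fractional difference involves countably many translates, so replacing \<open>f\<close> by a
  Borel representative changes it only on a null set. Afterwards the translation by \<open>ah\<close> is removed.
\<close>

lemma nn_integral_frac_diff:
  fixes f g :: "real ^ 'n \<Rightarrow> complex"
  assumes [measurable]: "g \<in> borel_measurable borel" and fg: "AE x in lborel. f x = g x"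
  shows "(\<integral>\<^sup>+x. ennreal (norm (frac_diff a h f x) powr p / norm h powr r) \<partial>lebesgue) =
    frac_modulus p a g h * ennreal (norm h powr (- r))"
proof -
  have "AE x in lborel. \<forall>j. f (x + (a - real j) *\<^sub>R h) = g (x + (a - real j) *\<^sub>R h)"
    unfolding AE_all_countable using AE_lborel_translate[OF fg] by blast
  then have "AE x in lborel. frac_diff a h f x = frac_diff a h g x"
    by eventually_elim (simp add: frac_diff_def)
  then have "(\<integral>\<^sup>+x. ennreal (norm (frac_diff a h f x) powr p / norm h powr r) \<partial>lebesgue) =
      (\<integral>\<^sup>+x. ennreal (norm (frac_diff a h g x) powr p / norm h powr r) \<partial>lborel)"
    unfolding nn_integral_completion by (intro nn_integral_cong_AE) (erule eventually_mono, simp)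
  also have "\<dots> = (\<integral>\<^sup>+x. ennreal (norm (fps_shift_sum (binom_fps a) h g (x + a *\<^sub>R h)) powr p) *
      ennreal (norm h powr (- r)) \<partial>lborel)"
    by (simp add: frac_diff_eq_fps_shift_sum powr_minus divide_inverse flip: ennreal_mult)
  also have "\<dots> = (\<integral>\<^sup>+x. ennreal (norm (fps_shift_sum (binom_fps a) h g x) powr p) *
      ennreal (norm h powr (- r)) \<partial>lborel)"
    by (rule nn_integral_lborel_translate) measurable
  also have "\<dots> = frac_modulus p a g h * ennreal (norm h powr (- r))"
    unfolding frac_modulus_def by (rule nn_integral_multc) measurable
  finally show ?thesis .
qed

lemma Butzer_seminorm_eq:
  fixes f g :: "real ^ 'n \<Rightarrow> complex"
  assumes "g \<in> borel_measurable borel" "AE x in lborel. f x = g x"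
  shows "Butzer_seminorm s p a f = ennreal_pow
    (\<integral>\<^sup>+h. frac_modulus p a g h * ennreal (norm h powr (- (s * p + DIM(real ^ 'n)))) \<partial>lborel) (1 / p)"
  unfolding Butzer_seminorm_def nn_integral_frac_diff[OF assms]
  by (simp add: nn_integral_completion)

lemma frac_diff_1: "frac_diff 1 h f x = f (x + h) - f x"
proof -
  have "((-1) ^ j * (1 gchoose j :: real)) = (if j = 0 then 1 else if j = 1 then -1 else 0)" for j
    using binom_fps_1 binom_fps_nth[of 1 j] by (auto simp: fps_X_def)
  then have "frac_diff 1 h f x = (\<Sum>j. (if j = 0 then 1 else if j = 1 then -1 else 0) *\<^sub>R f (x + (1 - real j) *\<^sub>R h))"
    by (simp add: frac_diff_def)
  also have "\<dots> = (\<Sum>j\<in>{0,1}. (if j = 0 then 1 else if j = 1 then -1 else 0) *\<^sub>R f (x + (1 - real j) *\<^sub>R h))"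
    by (rule suminf_finite) auto
  finally show ?thesis by simp
qed

text \<open>
  Substitute \<open>x = y + h\<close> in the inner integral and exchange the order of integration. Tonelli's
  theorem requires joint measurability, hence the Borel representative.
\<close>

lemma Gagliardo_seminorm_eq_Butzer_seminorm:
  fixes f :: "real ^ 'n \<Rightarrow> complex"
  assumes "f \<in> borel_measurable lebesgue"
  shows "Gagliardo_seminorm s p f = Butzer_seminorm s p 1 f"
proof -
  obtain g where g [measurable]: "g \<in> borel_measurable borel" and fg: "AE x in lborel. f x = g x"
    using lebesgue_measurable_complex_borel_representative[OF assms] by blast
  let ?q = "s * p + real CARD('n)"
  let ?k = "\<lambda>x h. ennreal (norm (g (x + h) - g x) powr p) * ennreal (norm h powr (- ?q))"
  have split: "ennreal (u powr p / v powr q) = ennreal (u powr p) * ennreal (v powr (- q))" for u v q :: real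
    by (simp add: powr_minus divide_inverse flip: ennreal_mult)
  have "(\<integral>\<^sup>+y. (\<integral>\<^sup>+x. ennreal (norm (f x - f y) powr p / norm (x - y) powr ?q) \<partial>lebesgue) \<partial>lebesgue) =
      (\<integral>\<^sup>+y. (\<integral>\<^sup>+x. ?k y (x - y) \<partial>lborel) \<partial>lborel)"
    unfolding nn_integral_completion
  proof (rule nn_integral_cong_AE)
    show "AE y in lborel. (\<integral>\<^sup>+x. ennreal (norm (f x - f y) powr p / norm (x - y) powr ?q) \<partial>lborel) =
        (\<integral>\<^sup>+x. ?k y (x - y) \<partial>lborel)"
      using fg
    proof eventually_elim
      case (elim y)
      then show ?case
        by (intro nn_integral_cong_AE) (use fg in eventually_elim, simp add: split)
    qed
  qed
  also have "\<dots> = (\<integral>\<^sup>+y. (\<integral>\<^sup>+h. ?k y h \<partial>lborel) \<partial>lborel)"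
  proof (rule nn_integral_cong)
    fix y
    show "(\<integral>\<^sup>+x. ?k y (x - y) \<partial>lborel) = (\<integral>\<^sup>+h. ?k y h \<partial>lborel)"
      using nn_integral_lborel_translate[of "?k y" "- y"] by simp
  qed
  also have "\<dots> = (\<integral>\<^sup>+h. (\<integral>\<^sup>+x. ?k x h \<partial>lborel) \<partial>lborel)"
    by (rule lborel_pair.Fubini') measurable
  also have "\<dots> = (\<integral>\<^sup>+h. (\<integral>\<^sup>+x. ennreal (norm (frac_diff 1 h g x) powr p / norm h powr ?q) \<partial>lebesgue) \<partial>lborel)"
    unfolding nn_integral_completion frac_diff_1 split ..
  also have "\<dots> = (\<integral>\<^sup>+h. frac_modulus p 1 g h * ennreal (norm h powr (- ?q)) \<partial>lborel)"
    by (intro nn_integral_cong nn_integral_frac_diff) auto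
  finally show ?thesis
    unfolding Butzer_seminorm_eq[OF g fg] Gagliardo_seminorm_def by simp
qed

section \<open>Monotonicity in the smoothness parameter\<close>

text \<open>
  The bounds for \<open>frac_modulus\<close> hold with constants common to all functions, so the resulting
  constant depends on \<open>p\<close>, \<open>a\<close> and the dimension alone.
\<close>

theorem Butzer_seminorm_monotone:
  fixes p a :: real
  assumes p: "1 \<le> p" and a: "0 < a"
  shows "\<exists>C::real. C > 0 \<and>
    (\<forall>s t. \<forall>f \<in> (Lp p :: (real ^ 'n \<Rightarrow> complex) set). 0 < s \<and> s < t \<and> t < a \<longrightarrow>
       Lp_norm p f + ennreal (min s (a - s) powr (1 / p)) * Butzer_seminorm s p a f
       \<le> ennreal C *
          (Lp_norm p f + ennreal (min t (a - t) powr (1 / p)) * Butzer_seminorm t p a f))"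
proof -
  obtain B where B: "B \<ge> 0" "\<And>g :: real ^ 'n \<Rightarrow> complex. \<And>h. Lp_function p g \<Longrightarrow>
      frac_modulus p a g h \<le> ennreal B * (\<integral>\<^sup>+x. ennreal (norm (g x) powr p) \<partial>lborel)"
    using frac_modulus_bound[of a p] a by (metis less_imp_le)
  obtain K where K: "K > 0" "\<And>g :: real ^ 'n \<Rightarrow> complex. \<And>M h. Lp_function p g \<Longrightarrow> M > 0 \<Longrightarrow>
      frac_modulus p a g (real M *\<^sub>R h) \<le> ennreal (K * real M powr (a * p)) * frac_modulus p a g h"
    using frac_modulus_dilate[OF a, of p] by metis
  define A' where "A' = 2 ^ DIM(real ^ 'n) * measure lborel (ball (0 :: real ^ 'n) 1) * (a + 1 / (p * ln 2))"
  define A where "A = A' * B"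
  define D where "D = 2 + 2 * K * (1 + a * p * ln 2)"
  have "0 \<le> a + 1 / (p * ln 2)" using a p by (intro add_nonneg_nonneg) auto
  then have A': "0 \<le> A'" unfolding A'_def by (intro mult_nonneg_nonneg) auto
  then have A: "0 \<le> A" unfolding A_def using B by (intro mult_nonneg_nonneg) auto
  have D: "0 \<le> D" unfolding D_def using K a p by (intro add_nonneg_nonneg mult_nonneg_nonneg) auto
  have "Lp_norm p f + ennreal (min s (a - s) powr (1 / p)) * Butzer_seminorm s p a f
       \<le> ennreal (1 + (1 + A + D) powr (1 / p)) *
          (Lp_norm p f + ennreal (min t (a - t) powr (1 / p)) * Butzer_seminorm t p a f)"
    if f: "f \<in> Lp p" and st: "0 < s" "s < t" "t < a" for s t and f :: "real ^ 'n \<Rightarrow> complex"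
  proof -
    have "f \<in> borel_measurable lebesgue" using f by (simp add: Lp_def)
    then obtain g where g: "g \<in> borel_measurable borel" and fg: "AE x in lborel. f x = g x"
      using lebesgue_measurable_complex_borel_representative by blast
    define N where "N = (\<integral>\<^sup>+x. ennreal (norm (g x) powr p) \<partial>lborel)"
    have fN: "(\<integral>\<^sup>+x. ennreal (norm (f x) powr p) \<partial>lebesgue) = N"
      unfolding nn_integral_completion N_def
      by (intro nn_integral_cong_AE) (use fg in eventually_elim, simp)
    have "N < \<infinity>"
      using f unfolding fN[symmetric] by (auto simp: Lp_def integrable_iff_bounded)
    then have gp: "Lp_function p g"
      using p g by unfold_locales (auto simp: N_def)
    interpret scaled_modulus "frac_modulus p a g" a p K
      using g a p K gp by unfold_locales auto
    have "ennreal (min s (a - s)) * weighted_integral s \<le>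
        ennreal A' * (ennreal B * N) + ennreal D * (ennreal (min t (a - t)) * weighted_integral t)"
      unfolding A'_def D_def using B(2)[OF gp] st by (intro weighted_integral_compare) (auto simp: N_def)
    also have "ennreal A' * (ennreal B * N) = ennreal A * N"
      unfolding A_def using B(1) A' by (simp add: ennreal_mult mult.assoc)
    finally have "ennreal_pow N (1 / p) + ennreal (min s (a - s) powr (1 / p)) * ennreal_pow (weighted_integral s) (1 / p)
        \<le> ennreal (1 + (1 + A + D) powr (1 / p)) *
      (ennreal_pow N (1 / p) + ennreal (min t (a - t) powr (1 / p)) * ennreal_pow (weighted_integral t) (1 / p))"
      using p st A D by (intro ennreal_pow_compare) auto
    then show ?thesis
      unfolding Butzer_seminorm_eq[OF g fg] Lp_norm_def fN weighted_integral_def .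
  qed
  moreover have "0 < 1 + (1 + A + D) powr (1 / p)" by (intro add_pos_nonneg) auto
  ultimately show ?thesis by blast
qed

text \<open>
  The second estimate is the first one for \<open>\<alpha> = 1\<close>, with the same constant, because the two seminorms
  then coincide.
\<close>

theorem theorem3p9:
  fixes p \<alpha> :: real
  assumes "1 < p" and "0 < \<alpha>"
  shows "\<exists>C::real. C > 0 \<and>
    (\<forall>s t. \<forall>f \<in> (Lp p :: (real ^ 'n \<Rightarrow> complex) set). 0 < s \<and> s < t \<and> t < \<alpha> \<longrightarrow>
       Lp_norm p f + ennreal (min s (\<alpha> - s) powr (1 / p)) * Butzer_seminorm s p \<alpha> f
       \<le> ennreal C *
          (Lp_norm p f + ennreal (min t (\<alpha> - t) powr (1 / p)) * Butzer_seminorm t p \<alpha> f)) \<and>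
    (\<alpha> = 1 \<longrightarrow>
      (\<forall>s t. \<forall>f \<in> (Lp p :: (real ^ 'n \<Rightarrow> complex) set). 0 < s \<and> s < t \<and> t < 1 \<longrightarrow>
         Lp_norm p f + ennreal (min s (1 - s) powr (1 / p)) * Gagliardo_seminorm s p f
         \<le> ennreal C *
            (Lp_norm p f + ennreal (min t (1 - t) powr (1 / p)) * Gagliardo_seminorm t p f)))"
proof -
  obtain C where C: "C > 0"
    "\<forall>s t. \<forall>f \<in> (Lp p :: (real ^ 'n \<Rightarrow> complex) set). 0 < s \<and> s < t \<and> t < \<alpha> \<longrightarrow>
       Lp_norm p f + ennreal (min s (\<alpha> - s) powr (1 / p)) * Butzer_seminorm s p \<alpha> f
       \<le> ennreal C *
          (Lp_norm p f + ennreal (min t (\<alpha> - t) powr (1 / p)) * Butzer_seminorm t p \<alpha> f)"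
    using Butzer_seminorm_monotone[of p \<alpha>, where 'n = 'n] assms by (metis less_imp_le)
  have "Gagliardo_seminorm s p f = Butzer_seminorm s p 1 f" if "f \<in> Lp p" for s and f :: "real ^ 'n \<Rightarrow> complex"
    using that by (intro Gagliardo_seminorm_eq_Butzer_seminorm) (simp add: Lp_def)
  with C show ?thesis by (intro exI[of _ C]) auto
qed

end
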